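(* Let $w=(w_1,\dots,w_n)$ be distributed according to the stationary distribution of the multispecies TASEP on a ring with $n$ sites of type $(1,1,\dots,1)$. For $1\le i<j\le n$ and $2\le a\le j-i$, $$\mathbb P[w_1=i,\ w_a=j]=\frac1{n^2}.$$
   Context: Multispecies TASEP on a ring with $n$ sites of type $(1,\dots,1)$: the states are the permutations $w=(w_1,\dots,w_n)$ of $\{1,\dots,n\}$, with positions taken cyclically modulo $n$ ($w_i$ is the species of the particle at site $i$). It is the continuous-time Markov chain in which every particle carries an independent rate-$1$ exponential clock; when the clock of the particle of species $j$ rings, it exchanges positions with the particle of species $k$ immediately to its left if $k>j$, and nothing happens otherwise. It has a unique stationary distribution. *)

theory Defs
  imports "HOL-Combinatorics.Permutations" "HOL-Probability.Probability_Mass_Function"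
begin

text \<open>
  A state is a permutation \<open>w\<close> of \<open>{1..n}\<close>, viewed as a function: \<open>w i\<close> is the species of the
  particle at site \<open>i\<close>. Following the library convention for \<open>permutes\<close>, \<open>w\<close> is the identity
  outside \<open>{1..n}\<close>, so there are exactly \<open>n!\<close> states.
\<close>

definition tasep_states :: "nat \<Rightarrow> (nat \<Rightarrow> nat) set" where
  "tasep_states n = {w. w permutes {1..n}}"

definition left_site :: "nat \<Rightarrow> nat \<Rightarrow> nat" where
  "left_site n i = (if i = 1 then n else i - 1)"

text \<open>
  The rate from \<open>u\<close> to \<open>v\<close> counts the particles, indexed here by their sites in \<open>u\<close>, whose clock
  (of rate 1) triggers an exchange that turns \<open>u\<close> into \<open>v\<close>.
\<close>

definition tasep_rate :: "nat \<Rightarrow> (nat \<Rightarrow> nat) \<Rightarrow> (nat \<Rightarrow> nat) \<Rightarrow> real" where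
  "tasep_rate n u v =
     real (card {i \<in> {1..n}. u (left_site n i) > u i \<and> v = u \<circ> Transposition.transpose (left_site n i) i})"

definition tasep_generator :: "nat \<Rightarrow> (nat \<Rightarrow> nat) \<Rightarrow> (nat \<Rightarrow> nat) \<Rightarrow> real" where
  "tasep_generator n u v =
     (if u = v then - (\<Sum>x \<in> tasep_states n - {u}. tasep_rate n u x) else tasep_rate n u v)"

text \<open>
  A stationary distribution of the continuous-time chain with generator \<open>Q\<close> is a probability
  distribution \<open>p\<close> on the finite state space with \<open>p Q = 0\<close>.
\<close>

definition tasep_stationary :: "nat \<Rightarrow> (nat \<Rightarrow> nat) pmf \<Rightarrow> bool" where
  "tasep_stationary n p \<longleftrightarrow>
     set_pmf p \<subseteq> tasep_states n \<and>
     (\<forall>v \<in> tasep_states n. (\<Sum>u \<in> tasep_states n. pmf p u * tasep_generator n u v) = 0)"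

end

theory Submission
  imports Defs
begin

text \<open>
  For \<open>s < t\<close> merge the species into the classes 1 (\<open>\<le> s\<close>), 2 (\<open>\<le> t\<close>) and 3 (\<open>> t\<close>).  The merged chain is
  again Markov, and its stationary law is that of the output of a queue on the ring with uniformly
  random sets of \<open>s\<close> arrivals and \<open>t\<close> services (Ferrari and Martin): label 1 is a used service, 2 an
  unused one, 3 no service.  If \<open>t - s \<ge> a - 1\<close>, then given that site \<open>a\<close> has label 3, whether site 1 has
  label 1 is decided by the queue on the sites after \<open>a\<close> alone; so site \<open>a\<close> can be removed from the
  ring, and rotation invariance on the smaller ring gives
  \<open>P(w\<^sub>1 \<le> s, w\<^sub>a > t) = s (n - t) / n\<^sup>2\<close>.  The claim is the mixed difference of this formula in \<open>s\<close>
  and \<open>t\<close>.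
\<close>

section \<open>The queue on a ring\<close>

text \<open>The law \<open>p\<close> is known only through p Q = 0, so the queue enters by
  uniqueness: the merged law and the number of queue configurations with given labels solve the same
  balance equation on three-letter words. Thresholds are used rather than the event
  \<open>w 1 = i \<and> w a = j\<close> itself because three classes need only one queue, whereas
  isolating two species takes up to five classes and several queues in tandem.

  The bound on \<open>a\<close> comes from the \<open>t - s\<close> wasted services. At most
  \<open>a - 2\<close> of them fall on sites 2 to \<open>a - 1\<close> and none on a site with label
  3, so at least one falls on a site after \<open>a\<close> or on site 1. The queue is empty there
  and everything earlier is forgotten. An arrival at site \<open>a\<close> is then without effect on
  site 1, but it lowers the number of arrivals left for the smaller ring; hence two counts, with
  \<open>s\<close> and with \<open>s - 1\<close> arrivals, are added. The result s (n - t) / n^2 is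
  the product of the marginals s / n and (n - t) / n: the two events are independent in this
  range.\<close>

text \<open>
  A column \<open>(a, b)\<close> records whether there is an arrival (\<open>a\<close>) and a service (\<open>b\<close>) at a site; an
  arrival may be served at once.  Truncated subtraction discards an unused service.
\<close>

definition queue_step :: "bool \<times> bool \<Rightarrow> nat \<Rightarrow> nat" where
  "queue_step c q = q + of_bool (fst c) - of_bool (snd c)"

definition queue_label :: "bool \<times> bool \<Rightarrow> nat \<Rightarrow> nat" where
  "queue_label c q = (if \<not> snd c then 3 else if q = 0 \<and> \<not> fst c then 2 else 1)"

primrec queue_run :: "(bool \<times> bool) list \<Rightarrow> nat \<Rightarrow> nat" where
  "queue_run [] q = q"
| "queue_run (c # z) q = queue_run z (queue_step c q)"

primrec labels :: "(bool \<times> bool) list \<Rightarrow> nat \<Rightarrow> nat list" where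
  "labels [] q = []"
| "labels (c # z) q = queue_label c q # labels z (queue_step c q)"

abbreviation arrivals :: "(bool \<times> bool) list \<Rightarrow> nat" where
  "arrivals z \<equiv> length (filter fst z)"

abbreviation services :: "(bool \<times> bool) list \<Rightarrow> nat" where
  "services z \<equiv> length (filter snd z)"

text \<open>
  With fewer arrivals than services, one turn from the empty queue already ends in the unique
  queue length that is reproduced after a full turn.
\<close>

definition ring_labels :: "(bool \<times> bool) list \<Rightarrow> nat list" where
  "ring_labels z = labels z (queue_run z 0)"

lemma queue_run_append [simp]: "queue_run (u @ v) q = queue_run v (queue_run u q)"
  by (induction u arbitrary: q) auto

lemma labels_append [simp]: "labels (u @ v) q = labels u q @ labels v (queue_run u q)"
  by (induction u arbitrary: q) auto

lemma length_labels [simp]: "length (labels z q) = length z"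
  by (induction z arbitrary: q) auto

lemma length_ring_labels [simp]: "length (ring_labels z) = length z"
  by (simp add: ring_labels_def)

lemma set_labels: "set (labels z q) \<subseteq> {1, 2, 3}"
  by (induction z arbitrary: q) (auto simp: queue_label_def)

text \<open>Until a service is wasted, the run from \<open>q\<close> just moves by the net number of
  arrivals. Once one is wasted, the run is at 0; by monotonicity so is the run from the empty queue,
  and the two coincide from then on.\<close>

lemma queue_run_max:
  "int (queue_run z q) = max (int q + int (arrivals z) - int (services z)) (int (queue_run z 0))"
proof (induction z arbitrary: q)
  case (Cons c z)
  show ?case
    unfolding queue_run.simps Cons.IH[of "queue_step c q"] Cons.IH[of "queue_step c 0"]
    by (cases "fst c"; cases "snd c"; cases q) (auto simp: queue_step_def)
qed simp

text \<open>Under the surplus the first branch of \<open>queue_run_max\<close> ends below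
  \<open>q\<close>, so a length that reproduces itself must be the second branch.\<close>

lemma queue_run_fixed_iff:
  assumes "arrivals z < services z"
  shows "queue_run z q = q \<longleftrightarrow> q = queue_run z 0"
  using queue_run_max[of z q] assms by linarith

lemma queue_run_0_le: "queue_run z 0 \<le> arrivals z"
proof -
  have "queue_run z q \<le> q + arrivals z" for q
  proof (induction z arbitrary: q)
    case (Cons c z)
    show ?case
      using Cons.IH[of "queue_step c q"]
      by (cases "fst c"; cases "snd c") (auto simp: queue_step_def)
  qed simp
  from this[of 0] show ?thesis by simp
qed

lemma labels_conservation:
  "queue_run z q + count_list (labels z q) 1 = q + arrivals z"
proof (induction z arbitrary: q)
  case (Cons c z)
  show ?case using Cons.IH[of "queue_step c q"]
    by (cases "fst c"; cases "snd c") (auto simp: queue_step_def queue_label_def)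
qed simp

lemma labels_services:
  "count_list (labels z q) 1 + count_list (labels z q) 2 = services z"
  by (induction z arbitrary: q) (auto simp: queue_label_def)

lemma labels_unserved:
  "count_list (labels z q) 3 + services z = length z"
  by (induction z arbitrary: q) (auto simp: queue_label_def)

lemma nth_labels_eq_3_iff: "k < length z \<Longrightarrow> labels z q ! k = 3 \<longleftrightarrow> \<not> snd (z ! k)"
  by (induction z arbitrary: q k) (auto simp: queue_label_def nth_Cons split: nat.split)

text \<open>One step along the ring carries the reproduced queue length of \<open>z\<close> to a
  reproduced length of \<open>rotate1 z\<close>; uniqueness identifies it with the one that
  \<open>ring_labels\<close> uses.\<close>

lemma ring_labels_rotate1:
  assumes "arrivals z < services z"
  shows "ring_labels (rotate1 z) = rotate1 (ring_labels z)"
proof (cases z)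
  case (Cons c y)
  let ?q = "queue_run z 0"
  have "queue_run z ?q = ?q"
    using queue_run_fixed_iff[OF assms] by blast
  then have "queue_run (rotate1 z) (queue_step c ?q) = queue_step c ?q"
    by (simp add: Cons)
  moreover have "arrivals (rotate1 z) < services (rotate1 z)"
    using assms by (simp add: Cons split: if_splits)
  ultimately have "queue_run (rotate1 z) 0 = queue_step c ?q"
    using queue_run_fixed_iff by metis
  with \<open>queue_run z ?q = ?q\<close> show ?thesis
    by (simp add: ring_labels_def Cons)
qed (simp add: ring_labels_def)

text \<open>
  The columns of \<open>W\<close> come first after the last site.  If the services they contain are too few to
  use up the surplus, the queue has emptied before it comes round to the last site again, so that
  the arrivals in \<open>W\<close> do not influence it.
\<close>

lemma last_label_window:
  assumes z: "z = W @ V @ [(y, True)]"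
    and surplus: "arrivals z + services W < services z"
  shows "last (ring_labels z) = 1 \<longleftrightarrow> y \<or> 0 < queue_run V 0"
proof -
  define q where "q = queue_run z 0"
  define r where "r = queue_run W q"
  define k where "k = queue_run V r"
  have "arrivals z < services z"
    using surplus by linarith
  then have q: "queue_run z q = q"
    unfolding q_def using queue_run_fixed_iff by blast
  have "ring_labels z = labels W q @ labels V r @ [queue_label (y, True) k]"
    unfolding ring_labels_def q_def[symmetric] by (simp add: z k_def r_def)
  then have last: "last (ring_labels z) = 1 \<longleftrightarrow> y \<or> 0 < k"
    by (simp add: queue_label_def)
  have k: "int k = max (int r + int (arrivals V) - int (services V)) (int (queue_run V 0))"
    unfolding k_def by (rule queue_run_max)
  have r: "int r = max (int q + int (arrivals W) - int (services W)) (int (queue_run W 0))"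
    unfolding r_def by (rule queue_run_max)
  have qk: "q = queue_step (y, True) k"
    using q unfolding z k_def r_def by simp
  have "0 < k \<longleftrightarrow> 0 < queue_run V 0" if "\<not> y"
  proof -
    have q_k: "q = k - 1"
      using qk that by (simp add: queue_step_def)
    \<comment> \<open>If \<open>k\<close> were positive while \<open>V\<close> alone leaves nothing,
      then \<open>k = r + arrivals V - services V\<close>. Here \<open>r\<close> is at most
      \<open>arrivals W\<close>, or at most \<open>k - 1 + arrivals W\<close> if customers survive a
      full turn; \<open>arrivals W + arrivals V \<le> services V\<close> excludes both.\<close>
    have "arrivals W + arrivals V + services W < services W + services V + 1"
      using surplus that by (simp add: z)
    then show ?thesis
      using k r q_k queue_run_0_le[of W] by linarith
  qed
  then show ?thesis
    using last by (cases y) simp_all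
qed

section \<open>Weights of words and the matrix ansatz\<close>

definition ring_weight :: "nat list \<Rightarrow> nat" where
  "ring_weight w = card {z. arrivals z < services z \<and> ring_labels z = w}"

text \<open>
  The relations \<open>ring_weight_31\<close>, \<open>ring_weight_21\<close> and \<open>ring_weight_32\<close> below are those of the matrix
  ansatz: \<open>card (paths w q r)\<close> is the entry \<open>(q, r)\<close> of a product of infinite matrices, one for each
  letter of \<open>w\<close>, and \<open>ring_weight w\<close> is its trace.
\<close>

definition paths :: "nat list \<Rightarrow> nat \<Rightarrow> nat \<Rightarrow> (bool \<times> bool) list set" where
  "paths w q r = {z. labels z q = w \<and> queue_run z q = r}"

lemma finite_columns: "finite {z :: (bool \<times> bool) list. length z = N \<and> P z}"
proof (rule finite_subset)
  show "{z :: (bool \<times> bool) list. length z = N \<and> P z} \<subseteq> {z. set z \<subseteq> UNIV \<and> length z = N}"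
    by auto
  show "finite {z :: (bool \<times> bool) list. set z \<subseteq> UNIV \<and> length z = N}"
    by (rule finite_lists_length_eq) simp
qed

lemma finite_paths: "finite (paths w q r)"
  by (rule finite_subset[OF _ finite_columns[of "length w" "\<lambda>_. True"]]) (auto simp: paths_def)

lemma card_paths_Cons:
  "card (paths (l # w) q r) =
     (\<Sum>c\<in>UNIV. if queue_label c q = l then card (paths w (queue_step c q) r) else 0)"
proof -
  have "paths (l # w) q r =
      (\<Union>c\<in>{c. queue_label c q = l}. (#) c ` paths w (queue_step c q) r)" (is "_ = ?U")
  proof (intro set_eqI iffI)
    fix z assume "z \<in> paths (l # w) q r"
    then show "z \<in> ?U" by (cases z) (auto simp: paths_def)
  qed (auto simp: paths_def)
  moreover have "card ?U = (\<Sum>c\<in>{c. queue_label c q = l}. card (paths w (queue_step c q) r))"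
    by (subst card_UN_disjoint) (auto simp: finite_paths card_image)
  ultimately show ?thesis
    by (simp add: sum.If_cases)
qed

lemma UNIV_bool_pair: "UNIV = {(True, True), (True, False), (False, True), (False, False)}"
  by auto

text \<open>The matrices of the ansatz: letter 3 is the identity plus a shift up of the queue
  length, letter 1 the identity plus a shift down, letter 2 the projection onto the empty
  queue.\<close>

lemma card_paths_3: "card (paths (3 # w) q r) = card (paths w q r) + card (paths w (Suc q) r)"
  unfolding card_paths_Cons UNIV_bool_pair by (simp add: queue_label_def queue_step_def)

lemma card_paths_2: "card (paths (2 # w) q r) = (if q = 0 then card (paths w 0 r) else 0)"
  unfolding card_paths_Cons UNIV_bool_pair by (simp add: queue_label_def queue_step_def)

lemma card_paths_1:
  "card (paths (1 # w) q r) = card (paths w q r) + (if q = 0 then 0 else card (paths w (q - 1) r))"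
  unfolding card_paths_Cons UNIV_bool_pair by (simp add: queue_label_def queue_step_def)

text \<open>A letter 2 forces more services than arrivals on every closed path, so the path
  determines \<open>q\<close> and the diagonal terms are disjoint. This \<open>q\<close> is at most
  the number of arrivals, which cuts the trace off. Leaving \<open>K\<close> free lets words of
  different lengths share one range of summation.\<close>

lemma ring_weight_eq_sum_paths:
  assumes "2 \<in> set w" "length w \<le> K"
  shows "ring_weight w = (\<Sum>q\<le>K. card (paths w q q))"
proof -
  have surplus: "arrivals z < services z" if "z \<in> paths w q q" for z q
  proof -
    have "count_list w 1 = arrivals z" "count_list w 1 + count_list w 2 = services z"
      using that labels_conservation[of z q] labels_services[of z q] by (auto simp: paths_def)
    moreover have "count_list w 2 \<noteq> 0"
      using assms(1) by (simp add: count_list_0_iff)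
    ultimately show ?thesis by linarith
  qed
  have fixed: "q = queue_run z 0" if "z \<in> paths w q q" for z q
    using queue_run_fixed_iff[OF surplus[OF that]] that by (simp add: paths_def)
  have "{z. arrivals z < services z \<and> ring_labels z = w} = (\<Union>q\<in>{..K}. paths w q q)"
  proof (intro set_eqI iffI)
    fix z assume z: "z \<in> {z. arrivals z < services z \<and> ring_labels z = w}"
    have "queue_run z 0 \<le> length z"
      using queue_run_0_le[of z] length_filter_le[of fst z] by linarith
    moreover have "z \<in> paths w (queue_run z 0) (queue_run z 0)"
      using z queue_run_fixed_iff[of z] by (auto simp: paths_def ring_labels_def)
    ultimately show "z \<in> (\<Union>q\<in>{..K}. paths w q q)"
      using z assms(2) by auto
  next
    fix z assume "z \<in> (\<Union>q\<in>{..K}. paths w q q)"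
    then obtain q where q: "z \<in> paths w q q" by blast
    then show "z \<in> {z. arrivals z < services z \<and> ring_labels z = w}"
      using surplus[OF q] fixed[OF q] by (simp add: paths_def ring_labels_def)
  qed
  moreover have "card (\<Union>q\<in>{..K}. paths w q q) = (\<Sum>q\<le>K. card (paths w q q))"
    by (rule card_UN_disjoint) (use fixed in \<open>auto simp: finite_paths\<close>)
  ultimately show ?thesis by (simp add: ring_weight_def)
qed

text \<open>A shift up followed by a shift down is the identity, so (1 + up)(1 + down) = (1 + up) +
  (1 + down).\<close>

lemma ring_weight_31:
  assumes "2 \<in> set w"
  shows "ring_weight (3 # 1 # w) = ring_weight (3 # w) + ring_weight (1 # w)"
proof -
  let ?K = "length w + 2"
  have "card (paths (3 # 1 # w) q q) = card (paths (3 # w) q q) + card (paths (1 # w) q q)" for q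
    by (simp add: card_paths_3 card_paths_1 del: One_nat_def)
  then show ?thesis
    using assms by (simp add: ring_weight_eq_sum_paths[where K = ?K] sum.distrib)
qed

lemma ring_weight_21: "ring_weight (2 # 1 # w) = ring_weight (2 # w)"
proof -
  have "card (paths (2 # 1 # w) q q) = card (paths (2 # w) q q)" for q
    by (simp add: card_paths_2 card_paths_1 del: One_nat_def)
  then show ?thesis
    by (simp add: ring_weight_eq_sum_paths[where K = "length w + 2"])
qed

lemma ring_weight_32: "ring_weight (3 # 2 # w) = ring_weight (2 # w)"
proof -
  have "card (paths (3 # 2 # w) q q) = card (paths (2 # w) q q)" for q
    by (simp add: card_paths_2 card_paths_3)
  then show ?thesis
    by (simp add: ring_weight_eq_sum_paths[where K = "length w + 2"])
qed

lemma arrivals_rotate1 [simp]: "arrivals (rotate1 z) = arrivals z"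
  and services_rotate1 [simp]: "services (rotate1 z) = services z"
  by (cases z; simp)+

lemma ring_weight_rotate1: "ring_weight (rotate1 w) = ring_weight w"
proof -
  have "bij_betw rotate1 {z. arrivals z < services z \<and> ring_labels z = w}
      {z. arrivals z < services z \<and> ring_labels z = rotate1 w}"
  proof (rule bij_betwI')
    fix y assume y: "y \<in> {z. arrivals z < services z \<and> ring_labels z = rotate1 w}"
    obtain x where x: "y = rotate1 x"
      using surj_rotate1 by blast
    then have "rotate1 (ring_labels x) = rotate1 w"
      using y ring_labels_rotate1[of x] by auto
    then have "ring_labels x = w"
      by (simp add: inj_eq[OF inj_rotate1])
    then show "\<exists>x\<in>{z. arrivals z < services z \<and> ring_labels z = w}. y = rotate1 x"
      using x y by auto
  qed (auto simp: ring_labels_rotate1 inj_eq[OF inj_rotate1])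
  then show ?thesis
    unfolding ring_weight_def by (rule bij_betw_same_card[symmetric])
qed

lemma ring_weight_pos:
  assumes "set w \<subseteq> {1, 2, 3}" "2 \<in> set w"
  shows "0 < ring_weight w"
proof -
  \<comment> \<open>Every arrival is served at its own site, so the queue stays empty and each
    service without an arrival is wasted.\<close>
  define z where "z = map (\<lambda>l. (l = 1, l \<noteq> 3)) w"
  have "queue_run z 0 = 0 \<and> labels z 0 = w"
    unfolding z_def using assms(1)
    by (induction w) (auto simp: queue_step_def queue_label_def)
  then have "z \<in> paths w 0 0"
    by (simp add: paths_def)
  then have "0 < card (paths w 0 0)"
    using finite_paths card_gt_0_iff by blast
  also have "\<dots> \<le> (\<Sum>q\<le>length w. card (paths w q q))"
    by (rule member_le_sum) auto
  finally show ?thesis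
    using assms(2) by (simp add: ring_weight_eq_sum_paths[where K = "length w"])
qed

section \<open>Counting configurations\<close>

definition two_lines :: "nat \<Rightarrow> nat \<Rightarrow> nat \<Rightarrow> (bool \<times> bool) list set" where
  "two_lines N s t = {z. length z = N \<and> arrivals z = s \<and> services z = t}"

lemma finite_two_lines [simp]: "finite (two_lines N s t)"
  unfolding two_lines_def by (rule finite_columns)

lemma card_bool_lists:
  "card {x :: bool list. length x = N \<and> length (filter (\<lambda>b. b) x) = k} = N choose k"
proof (induction N arbitrary: k)
  case 0
  have *: "{x :: bool list. length x = 0 \<and> length (filter (\<lambda>b. b) x) = k} = (if k = 0 then {[]} else {})"
    by auto
  show ?case
    unfolding * by simp
next
  case (Suc N)
  let ?S = "\<lambda>N k. {x :: bool list. length x = N \<and> length (filter (\<lambda>b. b) x) = k}"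
  have fin: "finite (?S N k)" for k
    by (rule finite_subset[OF _ finite_lists_length_eq[of UNIV N]]) auto
  show ?case
  proof (cases k)
    case 0
    have "?S (Suc N) 0 = (#) False ` ?S N 0"
      by (auto simp: length_Suc_conv image_iff split: if_splits)
    then have "card (?S (Suc N) 0) = card (?S N 0)"
      by (simp only:) (rule card_image, simp)
    then show ?thesis
      by (simp only: 0 Suc.IH binomial_n_0)
  next
    case (Suc k')
    have "?S (Suc N) k = (#) True ` ?S N k' \<union> (#) False ` ?S N k"
    proof (rule set_eqI)
      fix x
      show "x \<in> ?S (Suc N) k \<longleftrightarrow> x \<in> (#) True ` ?S N k' \<union> (#) False ` ?S N k"
        by (cases x; cases "hd x") (auto simp: Suc)
    qed
    moreover have "card \<dots> = card ((#) True ` ?S N k') + card ((#) False ` ?S N k)"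
      by (rule card_Un_disjoint) (use fin in auto)
    ultimately show ?thesis
      by (simp add: Suc Suc.IH card_image)
  qed
qed

lemma card_two_lines: "card (two_lines N s t) = (N choose s) * (N choose t)"
proof -
  let ?S = "\<lambda>k. {x :: bool list. length x = N \<and> length (filter (\<lambda>b. b) x) = k}"
  have "bij_betw (\<lambda>z. (map fst z, map snd z)) (two_lines N s t) (?S s \<times> ?S t)"
  proof (rule bij_betwI[where g = "\<lambda>(x, y). zip x y"])
    show "(\<lambda>z. (map fst z, map snd z)) \<in> two_lines N s t \<rightarrow> ?S s \<times> ?S t"
      by (auto simp: two_lines_def filter_map o_def)
    show "(\<lambda>(x, y). zip x y) \<in> ?S s \<times> ?S t \<rightarrow> two_lines N s t"
    proof (clarsimp simp: two_lines_def)
      fix x y :: "bool list"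
      assume len: "length y = length x"
      have "length (filter (\<lambda>b. b) (map fst (zip x y))) = length (filter (\<lambda>b. b) x)"
        "length (filter (\<lambda>b. b) (map snd (zip x y))) = length (filter (\<lambda>b. b) y)"
        using len by simp_all
      then show "arrivals (zip x y) = length (filter (\<lambda>b. b) x) \<and>
          services (zip x y) = length (filter (\<lambda>b. b) y)"
        by (simp add: filter_map o_def)
    qed
  qed (auto simp: zip_map_fst_snd)
  then have "card (two_lines N s t) = card (?S s \<times> ?S t)"
    by (rule bij_betw_same_card)
  then show ?thesis
    by (simp add: card_cartesian_product card_bool_lists)
qed

lemma card_two_lines_rotate1:
  "card {z \<in> two_lines N s t. P (rotate1 z)} = card {z \<in> two_lines N s t. P z}"
proof -
  have "rotate1 ` two_lines N s t = two_lines N s t"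
    by (rule endo_inj_surj[OF finite_two_lines])
      (auto simp: two_lines_def intro: inj_on_subset[OF inj_rotate1])
  moreover have "inj_on rotate1 (two_lines N s t)"
    using inj_rotate1 by (rule inj_on_subset) simp
  ultimately have "bij_betw rotate1 (two_lines N s t) (two_lines N s t)"
    by (simp add: bij_betw_def)
  then have "bij_betw rotate1 {z \<in> two_lines N s t. P (rotate1 z)} {z \<in> two_lines N s t. P z}"
    by (rule bij_betw_Collect) simp
  then show ?thesis
    by (rule bij_betw_same_card)
qed

lemma count_list_eq_card: "count_list xs x = card {k. k < length xs \<and> xs ! k = x}"
  by (simp add: count_list_eq_length_filter length_filter_conv_card eq_commute)

section \<open>Used services and the deletion of a site without service\<close>

definition served_last :: "nat \<Rightarrow> nat \<Rightarrow> nat \<Rightarrow> (bool \<times> bool) list set" where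
  "served_last N s t = {z \<in> two_lines N s t. last (ring_labels z) = 1}"

text \<open>Each of the \<open>s\<close> arrivals is served at exactly one site, and all sites are alike by rotation.\<close>

lemma card_served_last:
  assumes "s < t" "0 < N"
  shows "N * card (served_last N s t) = s * ((N choose s) * (N choose t))"
proof -
  define C where "C k = card {z \<in> two_lines N s t. ring_labels z ! k = 1}" for k
  have surplus: "arrivals z < services z" if "z \<in> two_lines N s t" for z
    using that assms(1) by (simp add: two_lines_def)
  have step: "C (Suc k) = C k" if "Suc k < N" for k
  proof -
    have "C (Suc k) = card {z \<in> two_lines N s t. ring_labels (rotate1 z) ! k = 1}"
      unfolding C_def
    proof (intro arg_cong[of _ _ card] Collect_cong conj_cong refl)
      fix z assume z: "z \<in> two_lines N s t"
      then have "length z = N"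
        by (simp add: two_lines_def)
      then show "ring_labels z ! Suc k = 1 \<longleftrightarrow> ring_labels (rotate1 z) ! k = 1"
        using that nth_rotate1[of k "ring_labels z"] ring_labels_rotate1[OF surplus[OF z]] by simp
    qed
    then show ?thesis
      using card_two_lines_rotate1[where P = "\<lambda>z. ring_labels z ! k = 1"] by (simp only: C_def)
  qed
  have const: "C k = C (N - 1)" if "k < N" for k
  proof -
    have "k \<le> N - 1" using that by simp
    then show ?thesis
    proof (induction k rule: inc_induct)
      case (step n)
      then show ?case using \<open>\<And>k. Suc k < N \<Longrightarrow> C (Suc k) = C k\<close>[of n] by simp
    qed simp
  qed
  have last: "C (N - 1) = card (served_last N s t)"
    unfolding C_def served_last_def
  proof (intro arg_cong[of _ _ card] Collect_cong conj_cong refl)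
    fix z assume "z \<in> two_lines N s t"
    then have "length (ring_labels z) = N"
      by (simp add: two_lines_def)
    moreover from this have "ring_labels z \<noteq> []"
      using assms(2) by fastforce
    ultimately show "ring_labels z ! (N - 1) = 1 \<longleftrightarrow> last (ring_labels z) = 1"
      by (simp add: last_conv_nth)
  qed
  have "N * card (served_last N s t) = (\<Sum>k<N. C k)"
    using const last by simp
  also have "\<dots> = (\<Sum>k<N. \<Sum>z\<in>two_lines N s t. if ring_labels z ! k = 1 then 1 else 0)"
    by (simp add: C_def sum.If_cases Collect_conj_eq)
  also have "\<dots> = (\<Sum>z\<in>two_lines N s t. \<Sum>k<N. if ring_labels z ! k = 1 then 1 else 0)"
    by (rule sum.swap)
  also have "\<dots> = (\<Sum>z\<in>two_lines N s t. s)"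
  proof (rule sum.cong[OF refl])
    fix z assume z: "z \<in> two_lines N s t"
    have "(\<Sum>k<N. if ring_labels z ! k = 1 then 1 else 0) = card {k. k < N \<and> ring_labels z ! k = 1}"
      by (simp add: sum.If_cases Collect_conj_eq lessThan_def)
    also have "\<dots> = count_list (ring_labels z) 1"
      using z by (simp add: count_list_eq_card two_lines_def)
    also have "\<dots> = s"
      using labels_conservation[of z "queue_run z 0"] z
        queue_run_fixed_iff[OF surplus[OF z], of "queue_run z 0"]
      by (simp add: ring_labels_def two_lines_def)
    finally show "(\<Sum>k<N. if ring_labels z ! k = 1 then 1 else 0) = s" .
  qed
  finally show ?thesis
    by (simp add: card_two_lines)
qed

text \<open>Restores a deleted site with label 3. The flag \<open>x\<close> is a parameter because
  label 3 does not reveal whether the site has an arrival.\<close>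

definition insert_idle :: "nat \<Rightarrow> bool \<Rightarrow> (bool \<times> bool) list \<Rightarrow> (bool \<times> bool) list" where
  "insert_idle k x z = take k z @ (x, False) # drop k z"

lemma inj_insert_idle: "inj (insert_idle k x)"
proof (rule injI)
  fix u v assume "insert_idle k x u = insert_idle k x v"
  moreover have "take (min k (length z)) (insert_idle k x z) @
      drop (Suc (min k (length z))) (insert_idle k x z) = z" for z
    by (cases "k \<le> length z") (auto simp: insert_idle_def min_def)
  moreover have "length (insert_idle k x z) = Suc (length z)" for z
    by (simp add: insert_idle_def min_def)
  ultimately show "u = v"
    by (metis nat.inject)
qed

text \<open>Both rings have the same columns \<open>V\<close> between the window and the last site;
  the window is the first \<open>k\<close> columns, in one ring extended by the new one. It holds at
  most \<open>k\<close> services either way, so \<open>last_label_window\<close> reduces both labels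
  to the same condition on \<open>V\<close> and \<open>y\<close>.\<close>

lemma last_label_insert_idle:
  assumes "k < length z" "arrivals z + of_bool x + k < services z"
  shows "last (ring_labels (insert_idle k x z)) = 1 \<longleftrightarrow> last (ring_labels z) = 1"
proof -
  obtain V c where V: "drop k z = V @ [c]"
    using assms(1) by (metis drop_eq_Nil linorder_not_le rev_exhaust)
  define U where "U = take k z"
  have z: "z = U @ V @ [c]"
    by (metis U_def V append_take_drop_id)
  have ins: "insert_idle k x z = (U @ [(x, False)]) @ V @ [c]"
    by (simp add: insert_idle_def U_def V)
  have U: "services U \<le> k"
    unfolding U_def by (rule order.trans[OF length_filter_le]) simp
  obtain y b where c: "c = (y, b)" by force
  show ?thesis
  proof (cases b)
    case True
    have "last (ring_labels z) = 1 \<longleftrightarrow> y \<or> 0 < queue_run V 0"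
      by (rule last_label_window[where W = U]) (use z c True U assms(2) in auto)
    moreover have "last (ring_labels (insert_idle k x z)) = 1 \<longleftrightarrow> y \<or> 0 < queue_run V 0"
    proof (rule last_label_window[where W = "U @ [(x, False)]"])
      show "insert_idle k x z = (U @ [(x, False)]) @ V @ [(y, True)]"
        by (simp add: ins c True)
      have "arrivals (insert_idle k x z) = arrivals z + of_bool x"
        "services (insert_idle k x z) = services z"
        unfolding ins by (simp_all add: z)
      then show "arrivals (insert_idle k x z) + services (U @ [(x, False)]) < services (insert_idle k x z)"
        using U assms(2) by simp
    qed
    ultimately show ?thesis by simp
  next
    case False
    then have "last (ring_labels z) = 3" "last (ring_labels (insert_idle k x z)) = 3"
      unfolding ins ring_labels_def by (simp_all add: z c queue_label_def)
    then show ?thesis by simp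
  qed
qed

lemma insert_idle_take_drop:
  assumes "k < length z" "\<not> snd (z ! k)"
  shows "insert_idle k (fst (z ! k)) (take k z @ drop (Suc k) z) = z"
proof -
  have "(fst (z ! k), False) = z ! k"
    using assms(2) by (simp add: prod_eq_iff)
  then show ?thesis
    using assms(1) by (simp add: insert_idle_def id_take_nth_drop[symmetric])
qed

text \<open>Deleting column \<open>k\<close> leaves all \<open>t\<close> services and either
  \<open>s\<close> or \<open>s - 1\<close> arrivals. Together with the deleted arrival bit, the
  shorter configuration determines the original one.\<close>

lemma card_last_label_pair:
  assumes "k < N" "s + k < t"
  shows "card {z \<in> two_lines (Suc N) s t. ring_labels z ! k = 3 \<and> last (ring_labels z) = 1} =
    card (served_last N s t) + (if s = 0 then 0 else card (served_last N (s - 1) t))"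
proof -
  define Y where "Y x = {z. length z = N \<and> arrivals z + of_bool x = s \<and> services z = t \<and>
    last (ring_labels z) = 1}" for x
  have Y: "finite (Y x)" for x
    unfolding Y_def by (rule finite_columns)
  have ins: "length (insert_idle k x z) = Suc (length z)"
    "arrivals (insert_idle k x z) = arrivals z + of_bool x"
    "services (insert_idle k x z) = services z" for x z
  proof -
    have "filter P z = filter P (take k z) @ filter P (drop k z)" for P
      by (metis append_take_drop_id filter_append)
    then show "length (insert_idle k x z) = Suc (length z)"
      "arrivals (insert_idle k x z) = arrivals z + of_bool x"
      "services (insert_idle k x z) = services z"
      by (simp_all add: insert_idle_def min_def)
  qed
  have "{z \<in> two_lines (Suc N) s t. ring_labels z ! k = 3 \<and> last (ring_labels z) = 1} =
      insert_idle k True ` Y True \<union> insert_idle k False ` Y False" (is "?L = ?R")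
  proof (intro set_eqI iffI)
    fix z assume z: "z \<in> ?L"
    then have len: "length z = Suc N" by (simp add: two_lines_def)
    then have idle: "\<not> snd (z ! k)"
      using z nth_labels_eq_3_iff[of k z] assms(1) by (simp add: ring_labels_def)
    define x where "x = fst (z ! k)"
    define z' where "z' = take k z @ drop (Suc k) z"
    have eq: "insert_idle k x z' = z"
      unfolding x_def z'_def using insert_idle_take_drop idle len assms(1) by simp
    then have "length z' = N" "arrivals z' + of_bool x = s" "services z' = t"
      using ins[of x z'] z len by (auto simp: two_lines_def)
    moreover from this have "last (ring_labels z') = 1"
      using last_label_insert_idle[of k z' x] z assms eq by simp
    ultimately have "z' \<in> Y x"
      by (simp add: Y_def)
    then show "z \<in> ?R"
      using eq by (cases x) auto
  next
    have "insert_idle k x z \<in> ?L" if z: "z \<in> Y x" for x z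
    proof -
      have "insert_idle k x z ! k = (x, False)"
        using z assms(1) by (simp add: insert_idle_def nth_append Y_def)
      then have "ring_labels (insert_idle k x z) ! k = 3"
        using nth_labels_eq_3_iff[of k "insert_idle k x z"] z assms(1) ins
        by (simp add: ring_labels_def Y_def)
      moreover have "last (ring_labels (insert_idle k x z)) = 1"
        using last_label_insert_idle[of k z x] z assms by (simp add: Y_def)
      ultimately show ?thesis
        using z ins by (simp add: Y_def two_lines_def)
    qed
    then show "z \<in> ?R \<Longrightarrow> z \<in> ?L" for z
      by blast
  qed
  moreover have "card ?R = card (Y True) + card (Y False)"
  proof (subst card_Un_disjoint)
    have "insert_idle k True u \<noteq> insert_idle k False v" if "u \<in> Y True" "v \<in> Y False" for u v
    proof
      assume "insert_idle k True u = insert_idle k False v"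
      then have "insert_idle k True u ! k = insert_idle k False v ! k" by simp
      then show False
        using that assms(1) by (simp add: insert_idle_def nth_append Y_def)
    qed
    then show "insert_idle k True ` Y True \<inter> insert_idle k False ` Y False = {}"
      by auto
  qed (auto simp: Y card_image inj_on_subset[OF inj_insert_idle])
  moreover have "Y False = served_last N s t"
    by (auto simp: Y_def served_last_def two_lines_def)
  moreover have "Y True = (if s = 0 then {} else served_last N (s - 1) t)"
    by (auto simp: Y_def served_last_def two_lines_def)
  ultimately show ?thesis
    by simp
qed

text \<open>The two counts recombine through s C(N, s) + (s - 1) C(N, s - 1) = s N C(N + 1, s) / (N
  + 1), which cancels the factor \<open>N\<close> from \<open>card_served_last\<close>. The services
  contribute C(N, t) = (N + 1 - t) C(N + 1, t) / (N + 1).\<close>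

lemma last_label_pair_proportion:
  assumes "k < N" "s + k < t" "t \<le> Suc N"
  shows "real (card {z \<in> two_lines (Suc N) s t. ring_labels z ! k = 3 \<and> last (ring_labels z) = 1}) =
    real s * real (Suc N - t) / (real (Suc N))\<^sup>2 * real (card (two_lines (Suc N) s t))"
proof -
  define M where "M s = real (card (served_last N s t))" for s
  define a b where "a = real (Suc N choose s)" and "b = real (Suc N choose t)"
  have N: "0 < N" "s \<le> N" "real N > 0"
    using assms by auto
  have b: "real (N choose t) = real (Suc N - t) / real (Suc N) * b"
  proof -
    have "(Suc N - t) * (Suc N choose t) = Suc N * (N choose t)"
      by (metis binomial_absorb_comp diff_Suc_1)
    then have "real (Suc N - t) * b = real (Suc N) * real (N choose t)"
      unfolding b_def by (metis of_nat_mult)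
    then show ?thesis by (simp add: field_simps)
  qed
  have a: "real (N choose s) = real (Suc N - s) / real (Suc N) * a"
  proof -
    have "(Suc N - s) * (Suc N choose s) = Suc N * (N choose s)"
      by (metis binomial_absorb_comp diff_Suc_1)
    then have "real (Suc N - s) * a = real (Suc N) * real (N choose s)"
      unfolding a_def by (metis of_nat_mult)
    then show ?thesis by (simp add: field_simps)
  qed
  have M1: "real N * M s = real s * (real (N choose s) * real (N choose t))"
    unfolding M_def using card_served_last[of s t N] assms N by (metis add_lessD1 of_nat_mult)
  \<comment> \<open>At \<open>s = 0\<close> the right-hand side vanishes through the factor
    \<open>real s\<close>, in agreement with the guarded left-hand side.\<close>
  have M2: "real N * (if s = 0 then 0 else M (s - 1)) =
      (real s - 1) * (real s / real (Suc N) * a * real (N choose t))"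
  proof (cases s)
    case (Suc r)
    have "Suc r * (Suc N choose Suc r) = Suc N * (N choose r)"
      by (rule Suc_times_binomial)
    then have "real s * a = real (Suc N) * real (N choose r)"
      unfolding a_def Suc by (metis of_nat_mult)
    then have "real (N choose r) = real s / real (Suc N) * a"
      by (simp add: field_simps)
    moreover have "real N * M r = real r * (real (N choose r) * real (N choose t))"
      unfolding M_def using card_served_last[of r t N] assms N Suc
      by (metis Suc_lessD add_lessD1 of_nat_mult)
    ultimately show ?thesis
      using Suc by simp
  qed simp
  have "real N \<noteq> 0"
    using N by simp
  have "real N * (M s + (if s = 0 then 0 else M (s - 1))) =
      real N * (real s * real (Suc N - t) / (real (Suc N))\<^sup>2 * (a * b))"
    unfolding distrib_left M1 M2 a b using N
    by (simp add: divide_simps power2_eq_square) (simp add: algebra_simps)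
  then have "M s + (if s = 0 then 0 else M (s - 1)) =
      real s * real (Suc N - t) / (real (Suc N))\<^sup>2 * (a * b)"
    unfolding mult_left_cancel[OF \<open>real N \<noteq> 0\<close>] .
  then show ?thesis
    unfolding card_last_label_pair[OF assms(1,2)] card_two_lines
    by (simp add: M_def a_def b_def split: if_splits)
qed

section \<open>Stationarity of the queue weights\<close>

lemma map_upt_Suc_rotate1:
  assumes "\<And>x. \<zeta> (x + n) = \<zeta> x" "0 < n"
  shows "map \<zeta> [Suc i..<Suc i + n] = rotate1 (map \<zeta> [i..<i + n])"
  using assms by (simp add: upt_conv_Cons)

text \<open>
  Every term of the balance equation is a weight \<open>g i\<close> of the word with site \<open>i\<close> deleted, and
  \<open>g i = g (Suc i)\<close> if the two letters agree; this makes the difference of both sides telescope.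
\<close>

lemma ring_weight_balance:
  assumes period: "\<And>x. \<zeta> (x + n) = \<zeta> x" and range: "\<And>x. \<zeta> x \<in> {1, 2, 3}"
    and two: "2 \<in> set (map \<zeta> [0..<n])" and n: "2 \<le> n"
  shows "(\<Sum>i<n. if \<zeta> i < \<zeta> (Suc i)
             then real (ring_weight (\<zeta> (Suc i) # \<zeta> i # map \<zeta> [i + 2..<i + n])) else 0) =
         (\<Sum>i<n. if \<zeta> i > \<zeta> (Suc i)
             then real (ring_weight (\<zeta> i # \<zeta> (Suc i) # map \<zeta> [i + 2..<i + n])) else 0)"
proof -
  define g where "g i = real (ring_weight (map \<zeta> [Suc i..<i + n]))" for i
  \<comment> \<open>The signs 1, 0, -1 of the letters 1, 2, 3 play the part of the auxiliary
    matrices of the ansatz. A pair of letters 1 and 3 yields the weights with either of its sites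
    deleted; a pair containing one 2 yields only the weight with the other letter deleted.\<close>
  define \<phi> where "\<phi> i = (of_bool (\<zeta> i = 1) - of_bool (\<zeta> i = 3)) * g i" for i
  define R where "R i = map \<zeta> [i + 2..<i + n]" for i
  have upt2: "[Suc i..<i + n] = Suc i # [i + 2..<i + n]" for i
    using n by (simp add: upt_conv_Cons)
  have g: "g i = real (ring_weight (\<zeta> (Suc i) # R i))" for i
    by (simp add: g_def R_def upt2)
  have g': "g (Suc i) = real (ring_weight (\<zeta> i # R i))" for i
  proof -
    have "map \<zeta> [Suc (Suc i)..<Suc i + n] = rotate1 (\<zeta> i # R i)"
      using n by (simp add: R_def period)
    then show ?thesis
      by (simp only: g_def ring_weight_rotate1)
  qed
  have set: "set (map \<zeta> [i..<i + n]) = set (map \<zeta> [0..<n])" for i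
  proof (induction i)
    case (Suc i)
    have "0 < n" using n by simp
    show ?case
      unfolding map_upt_Suc_rotate1[of \<zeta> n, OF period \<open>0 < n\<close>] set_rotate1 by (rule Suc.IH)
  qed simp
  have word: "map \<zeta> [i..<i + n] = \<zeta> i # \<zeta> (Suc i) # R i" for i
    using n upt2[of i] by (simp add: R_def upt_conv_Cons)
  have two_R: "2 \<in> set (R i)" if "\<zeta> i \<noteq> 2" "\<zeta> (Suc i) \<noteq> 2" for i
  proof -
    have "2 \<in> set (map \<zeta> [i..<i + n])"
      unfolding set by (rule two)
    then show ?thesis
      using that unfolding word by auto
  qed
  have step: "(if \<zeta> i > \<zeta> (Suc i) then real (ring_weight (\<zeta> i # \<zeta> (Suc i) # R i)) else 0) -
      (if \<zeta> i < \<zeta> (Suc i) then real (ring_weight (\<zeta> (Suc i) # \<zeta> i # R i)) else 0) =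
      \<phi> (Suc i) - \<phi> i" for i
  proof -
    have "\<zeta> i = 1 \<or> \<zeta> i = 2 \<or> \<zeta> i = 3" "\<zeta> (Suc i) = 1 \<or> \<zeta> (Suc i) = 2 \<or> \<zeta> (Suc i) = 3"
      using range[of i] range[of "Suc i"] by auto
    then show ?thesis
      using two_R[of i] g[of i] g'[of i]
      by (elim disjE)
        (simp_all add: \<phi>_def ring_weight_31 ring_weight_21 ring_weight_32 del: One_nat_def)
  qed
  have "\<phi> n = \<phi> 0"
  proof -
    have "map \<zeta> [Suc n..<n + n] = map \<zeta> [Suc 0..<0 + n]"
    proof (rule nth_equalityI)
      fix i assume "i < length (map \<zeta> [Suc n..<n + n])"
      moreover have "\<zeta> (Suc n + i) = \<zeta> (Suc i)"
        using period[of "Suc i"] by (simp add: add.commute)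
      ultimately show "map \<zeta> [Suc n..<n + n] ! i = map \<zeta> [Suc 0..<0 + n] ! i"
        by (simp del: upt_Suc)
    qed simp
    then show ?thesis
      using period[of 0] by (simp add: \<phi>_def g_def)
  qed
  then have "(\<Sum>i<n. \<phi> (Suc i) - \<phi> i) = 0"
    by (simp add: sum_lessThan_telescope)
  then show ?thesis
    unfolding step[symmetric] sum_subtractf R_def by linarith
qed

text \<open>The representative of \<open>x\<close> modulo \<open>n\<close> in \<open>{1..n}\<close>.
  As 0 represents site \<open>n\<close>, the left neighbour of site 1 needs no separate case in sums
  over the ring.\<close>

definition site :: "nat \<Rightarrow> nat \<Rightarrow> nat" where
  "site n x = (x + n - 1) mod n + 1"

lemma site_add [simp]: "0 < n \<Longrightarrow> site n (x + n) = site n x"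
proof -
  assume "0 < n"
  then have "x + n + n - 1 = (x + n - 1) + n" by simp
  then show ?thesis by (simp add: site_def del: add_diff_assoc add_diff_assoc2)
qed

lemma site_in: "0 < n \<Longrightarrow> site n x \<in> {1..n}"
  by (simp add: site_def Suc_leI)

lemma site_0: "0 < n \<Longrightarrow> site n 0 = n"
  by (simp add: site_def)

lemma site_eq: "1 \<le> x \<Longrightarrow> x \<le> n \<Longrightarrow> site n x = x"
  by (cases x) (simp_all add: site_def)

lemma left_site_Suc: "x < n \<Longrightarrow> left_site n (Suc x) = site n x"
  by (cases "x = 0") (auto simp: left_site_def site_eq site_0)

lemma site_neq:
  assumes "x < y" "y < x + n"
  shows "site n y \<noteq> site n x"
proof
  assume "site n y = site n x"
  then have "(y + n - 1) mod n = (x + n - 1) mod n"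
    by (simp add: site_def)
  moreover have "x + n - 1 \<le> y + n - 1"
    using assms by simp
  ultimately have "n dvd (y + n - 1) - (x + n - 1)"
    by (metis mod_eq_dvd_iff_nat)
  moreover have "(y + n - 1) - (x + n - 1) = y - x"
    using assms by simp
  ultimately show False
    using assms by (auto dest: dvd_imp_le)
qed

text \<open>Site 1 is put last, so that \<open>last_label_window\<close> applies to it.\<close>

definition ring_word :: "nat \<Rightarrow> (nat \<Rightarrow> nat) \<Rightarrow> nat list" where
  "ring_word n \<eta> = map \<eta> ([2..<Suc n] @ [1])"

text \<open>\<open>t\<close> counts the letters 1 and 2 together because both are services of the
  queue; the parameters thus agree with those of \<open>two_lines\<close>.\<close>

definition words :: "nat \<Rightarrow> nat \<Rightarrow> nat \<Rightarrow> (nat \<Rightarrow> nat) set" where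
  "words n s t = {\<eta> \<in> {1..n} \<rightarrow>\<^sub>E {1, 2, 3}.
     card {x \<in> {1..n}. \<eta> x = 1} = s \<and> card {x \<in> {1..n}. \<eta> x \<noteq> 3} = t}"

lemma finite_words [simp]: "finite (words n s t)"
  unfolding words_def by (rule finite_subset[OF _ finite_PiE[of "{1..n}" "\<lambda>_. {1, 2, 3}"]]) auto

abbreviation swap :: "nat \<Rightarrow> nat \<Rightarrow> (nat \<Rightarrow> nat) \<Rightarrow> nat \<Rightarrow> nat" where
  "swap n i \<eta> \<equiv> \<eta> \<circ> Transposition.transpose (left_site n i) i"

lemma left_site_in: "i \<in> {1..n} \<Longrightarrow> left_site n i \<in> {1..n}"
  by (auto simp: left_site_def)

lemma card_transpose:
  assumes "a \<in> S" "b \<in> S"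
  shows "card {x \<in> S. P (\<eta> (Transposition.transpose a b x))} = card {x \<in> S. P (\<eta> x)}"
proof -
  have "bij_betw (Transposition.transpose a b) S S"
    using assms by (simp add: bij_betw_transpose_iff)
  then have "bij_betw (Transposition.transpose a b) {x \<in> S. P (\<eta> (Transposition.transpose a b x))} {x \<in> S. P (\<eta> x)}"
    by (rule bij_betw_Collect) simp
  then show ?thesis
    by (rule bij_betw_same_card)
qed

lemma swap_in_words:
  assumes "\<eta> \<in> words n s t" "i \<in> {1..n}"
  shows "swap n i \<eta> \<in> words n s t"
proof -
  note left_site_in[OF assms(2)]
  moreover have "swap n i \<eta> \<in> {1..n} \<rightarrow>\<^sub>E {1, 2, 3}"
    using assms left_site_in[OF assms(2)] unfolding words_def
    by (auto simp: PiE_iff extensional_def Transposition.transpose_def)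
  ultimately show ?thesis
    using assms card_transpose[of "left_site n i" "{1..n}" i "\<lambda>l. l = 1" \<eta>]
      card_transpose[of "left_site n i" "{1..n}" i "\<lambda>l. l \<noteq> 3" \<eta>]
    by (simp add: words_def)
qed

lemma ring_weight_sites:
  assumes "0 < n"
  shows "ring_weight (map (\<lambda>x. \<eta> (site n x)) [i..<i + n]) = ring_weight (ring_word n \<eta>)"
proof -
  have *: "ring_weight (map (\<lambda>x. \<eta> (site n x)) [i..<i + n]) =
      ring_weight (map (\<lambda>x. \<eta> (site n x)) [0..<0 + n])" for i
  proof (induction i)
    case (Suc i)
    then show ?case
      using map_upt_Suc_rotate1[of "\<lambda>x. \<eta> (site n x)" n i] assms
      by (simp only: site_add ring_weight_rotate1)
  qed simp
  have "[2..<2 + n] = [2..<Suc n] @ [Suc n]"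
    using assms by simp
  moreover have "site n (Suc n) = 1"
    using assms site_add[of n 1] site_eq[of 1 n] by simp
  ultimately have "map (\<lambda>x. \<eta> (site n x)) [2..<2 + n] = ring_word n \<eta>"
    by (simp add: ring_word_def site_eq del: upt_Suc)
  then show ?thesis
    using *[of i] *[of 2] by simp
qed

lemma two_in_word:
  assumes "\<eta> \<in> words n s t" "s < t"
  obtains x where "x \<in> {1..n}" "\<eta> x = 2"
proof -
  have "\<not> {x \<in> {1..n}. \<eta> x \<noteq> 3} \<subseteq> {x \<in> {1..n}. \<eta> x = 1}"
    using assms card_mono[of "{x \<in> {1..n}. \<eta> x = 1}" "{x \<in> {1..n}. \<eta> x \<noteq> 3}"]
    by (auto simp: words_def)
  then obtain x where "x \<in> {1..n}" "\<eta> x \<noteq> 3" "\<eta> x \<noteq> 1" by blast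
  moreover have "\<eta> x \<in> {1, 2, 3}"
    using assms(1) \<open>x \<in> {1..n}\<close> by (auto simp: words_def PiE_iff)
  ultimately show ?thesis
    using that by blast
qed

text \<open>Reading the ring from site \<open>x\<close> puts the letters exchanged by
  \<open>swap n (Suc x)\<close> first, which is the shape of \<open>ring_weight_balance\<close>; by
  rotation the starting site does not affect the weight.\<close>

lemma words_balance:
  assumes \<eta>: "\<eta> \<in> words n s t" and "s < t" and n: "2 \<le> n"
  shows "(\<Sum>i\<in>{1..n}. if \<eta> (left_site n i) < \<eta> i then real (ring_weight (ring_word n (swap n i \<eta>))) else 0) =
    (\<Sum>i\<in>{1..n}. if \<eta> (left_site n i) > \<eta> i then real (ring_weight (ring_word n \<eta>)) else 0)"
proof -
  define \<zeta> where "\<zeta> x = \<eta> (site n x)" for x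
  have n0: "0 < n" using n by simp
  have period: "\<zeta> (x + n) = \<zeta> x" for x
    using n0 by (simp add: \<zeta>_def)
  have range: "\<zeta> x \<in> {1, 2, 3}" for x
    using \<eta> site_in[OF n0, of x] by (auto simp: \<zeta>_def words_def PiE_iff)
  have two: "2 \<in> set (map \<zeta> [0..<n])"
  proof -
    obtain x where x: "x \<in> {1..n}" "\<eta> x = 2"
      using two_in_word \<eta> \<open>s < t\<close> .
    \<comment> \<open>Sites run over \<open>{1..n}\<close> but indices over \<open>{..<n}\<close>:
      site \<open>n\<close> has index 0.\<close>
    define y where "y = (if x = n then 0 else x)"
    have "\<zeta> y = 2" "y \<in> set [0..<n]"
      using x n0 by (auto simp: y_def \<zeta>_def site_eq site_0)
    then show ?thesis
      by (auto simp: image_iff intro!: bexI[of _ y])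
  qed
  have at_Suc: "\<eta> (Suc x) = \<zeta> (Suc x)" "\<eta> (left_site n (Suc x)) = \<zeta> x" if "x < n" for x
    unfolding \<zeta>_def using that by (simp_all add: site_eq left_site_Suc)
  have expand: "[x..<x + n] = x # Suc x # [x + 2..<x + n]" for x
    using n by (simp add: upt_conv_Cons)
  have weight: "ring_weight (ring_word n \<eta>) = ring_weight (\<zeta> x # \<zeta> (Suc x) # map \<zeta> [x + 2..<x + n])" for x
    using ring_weight_sites[OF n0, of \<eta> x, folded \<zeta>_def] by (simp only: expand list.map)
  have weight_swap: "ring_weight (ring_word n (swap n (Suc x) \<eta>)) =
      ring_weight (\<zeta> (Suc x) # \<zeta> x # map \<zeta> [x + 2..<x + n])" if "x < n" for x
  proof -
    have "map (\<lambda>y. swap n (Suc x) \<eta> (site n y)) [x + 2..<x + n] = map \<zeta> [x + 2..<x + n]"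
    proof (rule map_cong[OF refl])
      fix y assume y: "y \<in> set [x + 2..<x + n]"
      have "site n y \<noteq> site n x" "site n y \<noteq> site n (Suc x)"
        by (rule site_neq; use y in simp)+
      then show "swap n (Suc x) \<eta> (site n y) = \<zeta> y"
        using that by (simp add: left_site_Suc site_eq \<zeta>_def)
    qed
    moreover have "swap n (Suc x) \<eta> (site n x) = \<zeta> (Suc x)" "swap n (Suc x) \<eta> (site n (Suc x)) = \<zeta> x"
      using that by (simp_all add: left_site_Suc site_eq \<zeta>_def)
    ultimately show ?thesis
      using ring_weight_sites[OF n0, of "swap n (Suc x) \<eta>" x] by (simp only: expand list.map)
  qed
  have "(\<Sum>i\<in>{1..n}. if \<eta> (left_site n i) < \<eta> i then real (ring_weight (ring_word n (swap n i \<eta>))) else 0) =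
      (\<Sum>x<n. if \<zeta> x < \<zeta> (Suc x) then real (ring_weight (\<zeta> (Suc x) # \<zeta> x # map \<zeta> [x + 2..<x + n])) else 0)"
    unfolding One_nat_def sum.atLeast1_atMost_eq
    by (intro sum.cong refl) (simp add: at_Suc weight_swap del: comp_apply)
  also have "\<dots> = (\<Sum>x<n. if \<zeta> x > \<zeta> (Suc x) then real (ring_weight (\<zeta> x # \<zeta> (Suc x) # map \<zeta> [x + 2..<x + n])) else 0)"
    using period range two n by (rule ring_weight_balance)
  also have "\<dots> = (\<Sum>i\<in>{1..n}. if \<eta> (left_site n i) > \<eta> i then real (ring_weight (ring_word n \<eta>)) else 0)"
    unfolding One_nat_def sum.atLeast1_atMost_eq
    by (intro sum.cong refl) (simp add: at_Suc weight[symmetric] del: add_2_eq_Suc')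
  finally show ?thesis .
qed

section \<open>Uniqueness of the stationary weights\<close>

text \<open>
  Maximum principle: at an element where \<open>\<kappa> F - Q \<ge> 0\<close> vanishes, the balance equation forces it
  to vanish at all predecessors, so the sets where \<open>Q / F\<close> is maximal or minimal are closed under
  taking predecessors.
\<close>

lemma balance_unique:
  fixes F Q :: "'a \<Rightarrow> real"
  assumes fin: "finite \<Omega>" "finite I" and ne: "\<Omega> \<noteq> {}"
    and pos: "\<And>x. x \<in> \<Omega> \<Longrightarrow> 0 < F x"
    and pred: "\<And>x i. x \<in> \<Omega> \<Longrightarrow> i \<in> I \<Longrightarrow> asc i x \<Longrightarrow> \<pi> i x \<in> \<Omega>"
    and F: "\<And>x. x \<in> \<Omega> \<Longrightarrow> (\<Sum>i\<in>I. if asc i x then F (\<pi> i x) else 0) = (\<Sum>i\<in>I. if des i x then F x else 0)"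
    and Q: "\<And>x. x \<in> \<Omega> \<Longrightarrow> (\<Sum>i\<in>I. if asc i x then Q (\<pi> i x) else 0) = (\<Sum>i\<in>I. if des i x then Q x else 0)"
    and meet: "\<And>M M'. M \<subseteq> \<Omega> \<Longrightarrow> M' \<subseteq> \<Omega> \<Longrightarrow> M \<noteq> {} \<Longrightarrow> M' \<noteq> {} \<Longrightarrow>
      (\<And>x i. x \<in> M \<Longrightarrow> i \<in> I \<Longrightarrow> asc i x \<Longrightarrow> \<pi> i x \<in> M) \<Longrightarrow>
      (\<And>x i. x \<in> M' \<Longrightarrow> i \<in> I \<Longrightarrow> asc i x \<Longrightarrow> \<pi> i x \<in> M') \<Longrightarrow> M \<inter> M' \<noteq> {}"
  obtains \<kappa> where "\<And>x. x \<in> \<Omega> \<Longrightarrow> Q x = \<kappa> * F x"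
proof -
  have closed: "d (\<pi> i x) = 0"
    if d0: "\<And>y. y \<in> \<Omega> \<Longrightarrow> 0 \<le> d y" and d: "\<And>y. d y = a * F y + b * Q y"
      and x: "x \<in> \<Omega>" "d x = 0" and i: "i \<in> I" "asc i x" for d a b i x
  proof -
    have "(\<Sum>i\<in>I. if asc i x then d (\<pi> i x) else 0) =
        (\<Sum>i\<in>I. a * (if asc i x then F (\<pi> i x) else 0) + b * (if asc i x then Q (\<pi> i x) else 0))"
      by (intro sum.cong) (auto simp: d)
    also have "\<dots> = a * (\<Sum>i\<in>I. if des i x then F x else 0) + b * (\<Sum>i\<in>I. if des i x then Q x else 0)"
      by (simp add: sum.distrib F[OF x(1)] Q[OF x(1)] flip: sum_distrib_left)
    also have "\<dots> = (\<Sum>i\<in>I. if des i x then d x else 0)"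
      unfolding sum_distrib_left sum.distrib[symmetric] by (intro sum.cong) (auto simp: d)
    also have "\<dots> = 0"
      using x(2) by (intro sum.neutral) auto
    finally have "\<forall>i\<in>I. (if asc i x then d (\<pi> i x) else 0) = 0"
      using fin(2) d0 pred[OF x(1)] by (subst (asm) sum_nonneg_eq_0_iff) auto
    then show ?thesis
      using i by auto
  qed
  define h where "h x = Q x / F x" for x
  define \<kappa> \<mu> where "\<kappa> = Max (h ` \<Omega>)" and "\<mu> = Min (h ` \<Omega>)"
  have bounds: "\<mu> * F x \<le> Q x" "Q x \<le> \<kappa> * F x" if "x \<in> \<Omega>" for x
  proof -
    have "h x \<le> \<kappa>" "\<mu> \<le> h x"
      using that fin(1) by (simp_all add: \<kappa>_def \<mu>_def)
    then show "\<mu> * F x \<le> Q x" "Q x \<le> \<kappa> * F x"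
      using pos[OF that] by (simp_all add: h_def field_simps)
  qed
  define M where "M = {x \<in> \<Omega>. \<kappa> * F x + - 1 * Q x = 0}"
  define M' where "M' = {x \<in> \<Omega>. - \<mu> * F x + 1 * Q x = 0}"
  have "\<kappa> \<in> h ` \<Omega>" "\<mu> \<in> h ` \<Omega>"
    using fin(1) ne by (simp_all add: \<kappa>_def \<mu>_def)
  then have "M \<noteq> {}" "M' \<noteq> {}"
    using pos by (auto simp: M_def M'_def h_def less_imp_neq[THEN not_sym])
  moreover have "\<pi> i x \<in> M" if "x \<in> M" "i \<in> I" "asc i x" for x i
    using closed[of "\<lambda>y. \<kappa> * F y + - 1 * Q y" \<kappa> "- 1" x i] that bounds(2) pred[of x i]
    by (auto simp: M_def)
  moreover have "\<pi> i x \<in> M'" if "x \<in> M'" "i \<in> I" "asc i x" for x i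
    using closed[of "\<lambda>y. - \<mu> * F y + 1 * Q y" "- \<mu>" 1 x i] that bounds(1) pred[of x i]
    by (auto simp: M'_def)
  \<comment> \<open>Irreducibility enters in the form \<open>meet\<close>: two nonempty sets closed
    under predecessors share an element. There the maximum and the minimum of \<open>Q / F\<close>
    agree, so the quotient is constant.\<close>
  ultimately have "M \<inter> M' \<noteq> {}"
    by (intro meet) (auto simp: M_def M'_def)
  then obtain x where "x \<in> M" "x \<in> M'"
    by blast
  then have x: "x \<in> \<Omega>" "\<kappa> * F x = Q x" "Q x = \<mu> * F x"
    by (simp_all add: M_def M'_def)
  then have "\<kappa> = \<mu>"
    using pos[OF x(1)] by simp
  then have "Q y = \<kappa> * F y" if "y \<in> \<Omega>" for y
    using bounds[OF that] by simp
  then show ?thesis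
    by (rule that)
qed

lemma down_closed_eq_interval:
  fixes D :: "nat set"
  assumes "D \<subseteq> {1..n}" and down: "\<And>x y. x \<in> D \<Longrightarrow> 1 \<le> y \<Longrightarrow> y \<le> x \<Longrightarrow> y \<in> D"
    and card: "card D = m"
  shows "D = {1..m}"
proof -
  have "finite D"
    using assms(1) finite_subset by blast
  obtain k where "D = {1..k}"
  proof (cases "D = {}")
    case False
    have "D = {1..Max D}"
    proof (intro set_eqI iffI)
      fix x assume "x \<in> D"
      then show "x \<in> {1..Max D}"
        using assms(1) \<open>finite D\<close> by auto
    next
      fix x assume "x \<in> {1..Max D}"
      then show "x \<in> D"
        using down[OF Max_in[OF \<open>finite D\<close> False], of x] by simp
    qed
    then show ?thesis by (rule that)
  qed (use that[of 0] in simp)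
  then show ?thesis
    using card by simp
qed

text \<open>The letter counts force \<open>n - t\<close> letters 3, then \<open>t - s\<close>
  letters 2, then \<open>s\<close> letters 1. This is the word in which all closed sets
  meet.\<close>

lemma antitone_words_eq:
  assumes "\<eta> \<in> words n s t" "\<theta> \<in> words n s t"
    and "\<And>x y. 1 \<le> x \<Longrightarrow> x \<le> y \<Longrightarrow> y \<le> n \<Longrightarrow> \<eta> y \<le> \<eta> x"
    and "\<And>x y. 1 \<le> x \<Longrightarrow> x \<le> y \<Longrightarrow> y \<le> n \<Longrightarrow> \<theta> y \<le> \<theta> x"
  shows "\<eta> = \<theta>"
proof -
  have sets: "{x \<in> {1..n}. \<eta> x \<noteq> 1} = {1..n - s} \<and> {x \<in> {1..n}. \<eta> x = 3} = {1..n - t}"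
    if \<eta>: "\<eta> \<in> words n s t"
      and anti: "\<And>x y. 1 \<le> x \<Longrightarrow> x \<le> y \<Longrightarrow> y \<le> n \<Longrightarrow> \<eta> y \<le> \<eta> x" for \<eta>
  proof -
    have range: "\<eta> x = 1 \<or> \<eta> x = 2 \<or> \<eta> x = 3" if "x \<in> {1..n}" for x
      using \<eta> that by (auto simp: words_def PiE_iff)
    have compl: "card {x \<in> {1..n}. \<not> P x} = n - card {x \<in> {1..n}. P x}" for P
    proof -
      have "{x \<in> {1..n}. \<not> P x} = {1..n} - {x \<in> {1..n}. P x}" by auto
      then have "card {x \<in> {1..n}. \<not> P x} = card ({1..n} - {x \<in> {1..n}. P x})"
        by (rule arg_cong)
      also have "\<dots> = n - card {x \<in> {1..n}. P x}"
        by (subst card_Diff_subset) auto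
      finally show ?thesis .
    qed
    have card: "card {x \<in> {1..n}. \<eta> x \<noteq> 1} = n - s" "card {x \<in> {1..n}. \<eta> x = 3} = n - t"
      using \<eta> compl[of "\<lambda>x. \<eta> x = 1"] compl[of "\<lambda>x. \<eta> x \<noteq> 3"] by (simp_all add: words_def)
    have "{x \<in> {1..n}. \<eta> x \<noteq> 1} = {1..n - s}"
    proof (rule down_closed_eq_interval[OF _ _ card(1)])
      fix x y assume "x \<in> {x \<in> {1..n}. \<eta> x \<noteq> 1}" "1 \<le> y" "y \<le> x"
      then show "y \<in> {x \<in> {1..n}. \<eta> x \<noteq> 1}"
        using anti[of y x] range[of x] by auto
    qed auto
    moreover have "{x \<in> {1..n}. \<eta> x = 3} = {1..n - t}"
    proof (rule down_closed_eq_interval[OF _ _ card(2)])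
      fix x y assume "x \<in> {x \<in> {1..n}. \<eta> x = 3}" "1 \<le> y" "y \<le> x"
      then show "y \<in> {x \<in> {1..n}. \<eta> x = 3}"
        using anti[of y x] range[of y] by auto
    qed auto
    ultimately show ?thesis by (rule conjI)
  qed
  have eq: "{x \<in> {1..n}. \<eta> x \<noteq> 1} = {x \<in> {1..n}. \<theta> x \<noteq> 1}"
    "{x \<in> {1..n}. \<eta> x = 3} = {x \<in> {1..n}. \<theta> x = 3}"
    by (simp_all only: sets[OF assms(1,3)] sets[OF assms(2,4)])
  have "\<eta> x = \<theta> x" for x
  proof (cases "x \<in> {1..n}")
    case True
    have "\<eta> x \<noteq> 1 \<longleftrightarrow> \<theta> x \<noteq> 1" "\<eta> x = 3 \<longleftrightarrow> \<theta> x = 3"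
      using eq[unfolded set_eq_iff, rule_format, of x] True by simp_all
    moreover have "\<eta> x = 1 \<or> \<eta> x = 2 \<or> \<eta> x = 3" "\<theta> x = 1 \<or> \<theta> x = 2 \<or> \<theta> x = 3"
      using assms(1,2) True by (auto simp: words_def PiE_iff)
    ultimately show ?thesis by metis
  next
    case False
    then show ?thesis
      using assms(1,2) by (simp add: words_def PiE_iff extensional_def)
  qed
  then show ?thesis by blast
qed

text \<open>
  Exchanging an ascent at sites \<open>i - 1, i\<close> lowers \<open>\<Sum>x. x * \<eta> x\<close>, so a minimiser in a closed set is
  antitone.
\<close>

lemma closed_words_antitone:
  assumes M: "M \<subseteq> words n s t" "M \<noteq> {}"
    and closed: "\<And>\<eta> i. \<eta> \<in> M \<Longrightarrow> i \<in> {1..n} \<Longrightarrow> \<eta> (left_site n i) < \<eta> i \<Longrightarrow> swap n i \<eta> \<in> M"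
  obtains \<eta> where "\<eta> \<in> M" "\<And>x y. 1 \<le> x \<Longrightarrow> x \<le> y \<Longrightarrow> y \<le> n \<Longrightarrow> \<eta> y \<le> \<eta> x"
proof -
  define m where "m \<eta> = (\<Sum>x\<in>{1..n}. x * \<eta> x)" for \<eta> :: "nat \<Rightarrow> nat"
  obtain \<eta> where \<eta>: "\<eta> \<in> M" "\<And>\<theta>. \<theta> \<in> M \<Longrightarrow> m \<eta> \<le> m \<theta>"
    using M(2) ex_has_least_nat[of "\<lambda>\<eta>. \<eta> \<in> M" _ m] by blast
  have step: "\<eta> (Suc i) \<le> \<eta> i" if i: "1 \<le> i" "Suc i \<le> n" for i
  proof (rule ccontr)
    assume "\<not> \<eta> (Suc i) \<le> \<eta> i"
    then have lt: "\<eta> i < \<eta> (Suc i)" by simp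
    have left: "left_site n (Suc i) = i"
      using i by (simp add: left_site_def)
    let ?\<theta> = "swap n (Suc i) \<eta>"
    have "?\<theta> \<in> M"
      using closed[OF \<eta>(1), of "Suc i"] lt left i by simp
    have split: "m \<theta> = i * \<theta> i + Suc i * \<theta> (Suc i) + (\<Sum>x\<in>{1..n} - {i, Suc i}. x * \<theta> x)" for \<theta>
    proof -
      have "{1..n} = insert i (insert (Suc i) ({1..n} - {i, Suc i}))"
        using i by auto
      then have "m \<theta> = (\<Sum>x\<in>insert i (insert (Suc i) ({1..n} - {i, Suc i})). x * \<theta> x)"
        by (simp add: m_def)
      then show ?thesis
        by simp
    qed
    have "(\<Sum>x\<in>{1..n} - {i, Suc i}. x * ?\<theta> x) = (\<Sum>x\<in>{1..n} - {i, Suc i}. x * \<eta> x)"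
      by (intro sum.cong) (auto simp: left Transposition.transpose_def)
    then have "m ?\<theta> + \<eta> (Suc i) = m \<eta> + \<eta> i"
      unfolding split[of ?\<theta>] split[of \<eta>] by (simp add: left algebra_simps)
    then show False
      using \<eta>(2)[OF \<open>?\<theta> \<in> M\<close>] lt by simp
  qed
  have "\<eta> y \<le> \<eta> x" if "1 \<le> x" "x \<le> y" "y \<le> n" for x y
    using that(2,3)
  proof (induction y rule: dec_induct)
    case (step k)
    then show ?case
      using \<open>\<And>i. 1 \<le> i \<Longrightarrow> Suc i \<le> n \<Longrightarrow> \<eta> (Suc i) \<le> \<eta> i\<close>[of k] that(1) by simp
  qed simp
  then show ?thesis
    using that \<eta>(1) by blast
qed

lemma set_ring_word:
  assumes "0 < n"
  shows "set (ring_word n \<eta>) = \<eta> ` {1..n}"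
proof -
  have "set ([2..<Suc n] @ [1]) = {1..n}"
    using assms by auto
  then show ?thesis
    unfolding ring_word_def set_map by (rule arg_cong)
qed

lemma ring_word_pos:
  assumes "\<eta> \<in> words n s t" "s < t"
  shows "0 < ring_weight (ring_word n \<eta>)"
proof -
  obtain x where x: "x \<in> {1..n}" "\<eta> x = 2"
    using two_in_word assms .
  then have set: "set (ring_word n \<eta>) = \<eta> ` {1..n}"
    by (intro set_ring_word) simp
  show ?thesis
  proof (rule ring_weight_pos)
    show "set (ring_word n \<eta>) \<subseteq> {1, 2, 3}"
      unfolding set using assms(1) by (intro image_subsetI) (simp add: words_def PiE_iff)
    show "2 \<in> set (ring_word n \<eta>)"
      unfolding set using x by (intro image_eqI[of _ _ x]) simp_all
  qed
qed

text \<open>Every nonempty closed set contains an antitone word, and there is only one such word;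
  this supplies the hypothesis \<open>meet\<close> of \<open>balance_unique\<close>.\<close>

lemma words_balance_unique:
  fixes Q :: "(nat \<Rightarrow> nat) \<Rightarrow> real"
  assumes "s < t" "2 \<le> n"
    and Q: "\<And>\<eta>. \<eta> \<in> words n s t \<Longrightarrow>
      (\<Sum>i\<in>{1..n}. if \<eta> (left_site n i) < \<eta> i then Q (swap n i \<eta>) else 0) =
      (\<Sum>i\<in>{1..n}. if \<eta> (left_site n i) > \<eta> i then Q \<eta> else 0)"
  obtains \<kappa> where "\<And>\<eta>. \<eta> \<in> words n s t \<Longrightarrow> Q \<eta> = \<kappa> * real (ring_weight (ring_word n \<eta>))"
proof (cases "words n s t = {}")
  case True
  then show ?thesis using that by blast
next
  case False
  show ?thesis
  proof (rule balance_unique[of "words n s t" "{1..n}" "\<lambda>\<eta>. real (ring_weight (ring_word n \<eta>))"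
        "\<lambda>i \<eta>. \<eta> (left_site n i) < \<eta> i" "swap n" "\<lambda>i \<eta>. \<eta> (left_site n i) > \<eta> i" Q])
    fix M M'
    assume M: "M \<subseteq> words n s t" "M \<noteq> {}"
        "\<And>\<eta> i. \<eta> \<in> M \<Longrightarrow> i \<in> {1..n} \<Longrightarrow> \<eta> (left_site n i) < \<eta> i \<Longrightarrow> swap n i \<eta> \<in> M"
      and M': "M' \<subseteq> words n s t" "M' \<noteq> {}"
        "\<And>\<eta> i. \<eta> \<in> M' \<Longrightarrow> i \<in> {1..n} \<Longrightarrow> \<eta> (left_site n i) < \<eta> i \<Longrightarrow> swap n i \<eta> \<in> M'"
    obtain \<eta> where \<eta>: "\<eta> \<in> M" "\<And>x y. 1 \<le> x \<Longrightarrow> x \<le> y \<Longrightarrow> y \<le> n \<Longrightarrow> \<eta> y \<le> \<eta> x"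
      using closed_words_antitone[OF M] by blast
    obtain \<theta> where \<theta>: "\<theta> \<in> M'" "\<And>x y. 1 \<le> x \<Longrightarrow> x \<le> y \<Longrightarrow> y \<le> n \<Longrightarrow> \<theta> y \<le> \<theta> x"
      using closed_words_antitone[OF M'] by blast
    have "\<eta> = \<theta>"
      by (rule antitone_words_eq[of _ n s t]) (use \<eta> \<theta> M(1) M'(1) in auto)
    then show "M \<inter> M' \<noteq> {}"
      using \<eta>(1) \<theta>(1) by blast
  next
    fix \<kappa>
    assume "\<And>\<eta>. \<eta> \<in> words n s t \<Longrightarrow> Q \<eta> = \<kappa> * real (ring_weight (ring_word n \<eta>))"
    then show thesis by (rule that)
  next
    fix \<eta> assume "\<eta> \<in> words n s t"
    then show "0 < real (ring_weight (ring_word n \<eta>))"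
      using ring_word_pos assms(1) by simp
  next
    fix \<eta> i assume "\<eta> \<in> words n s t" "i \<in> {1..n}"
    then show "swap n i \<eta> \<in> words n s t"
      by (rule swap_in_words)
  next
    fix \<eta> assume "\<eta> \<in> words n s t"
    then show "(\<Sum>i\<in>{1..n}. if \<eta> (left_site n i) < \<eta> i
          then real (ring_weight (ring_word n (swap n i \<eta>))) else 0) =
        (\<Sum>i\<in>{1..n}. if \<eta> (left_site n i) > \<eta> i then real (ring_weight (ring_word n \<eta>)) else 0)"
      using assms(1,2) by (rule words_balance)
  qed (fact False Q finite_words finite_atLeastAtMost)+
qed

section \<open>Words and the queue configurations that produce them\<close>

lemma card_filter_map:
  assumes "distinct xs"
  shows "length (filter P (map \<eta> xs)) = card {x \<in> set xs. P (\<eta> x)}"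
proof -
  have "length (filter P (map \<eta> xs)) = length (filter (\<lambda>x. P (\<eta> x)) xs)"
    by (simp add: filter_map o_def)
  also have "\<dots> = card ({x. P (\<eta> x)} \<inter> set xs)"
    using assms by (rule distinct_length_filter)
  also have "{x. P (\<eta> x)} \<inter> set xs = {x \<in> set xs. P (\<eta> x)}"
    by auto
  finally show ?thesis .
qed

lemma ring_word_inj:
  assumes "\<eta> \<in> words n s t" "\<theta> \<in> words n s t" "ring_word n \<eta> = ring_word n \<theta>" "0 < n"
  shows "\<eta> = \<theta>"
proof (rule PiE_ext)
  show "\<eta> \<in> {1..n} \<rightarrow>\<^sub>E {1, 2, 3}" "\<theta> \<in> {1..n} \<rightarrow>\<^sub>E {1, 2, 3}"
    using assms by (auto simp: words_def)
  fix x assume "x \<in> {1..n}"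
  then have "x \<in> set ([2..<Suc n] @ [1])" by auto
  moreover have "\<forall>x\<in>set ([2..<Suc n] @ [1]). \<eta> x = \<theta> x"
    using assms(3) unfolding ring_word_def map_eq_conv .
  ultimately show "\<eta> x = \<theta> x"
    by (rule bspec[rotated])
qed

lemma ring_word_counts:
  assumes "0 < n"
  shows "count_list (ring_word n \<eta>) 1 = card {x \<in> {1..n}. \<eta> x = 1}"
    and "count_list (ring_word n \<eta>) 3 + card {x \<in> {1..n}. \<eta> x \<noteq> 3} = n"
proof -
  have sites: "set ([2..<Suc n] @ [1]) = {1..n}" "distinct ([2..<Suc n] @ [1])"
    using assms by auto
  have count: "length (filter P (ring_word n \<eta>)) = card {x \<in> {1..n}. P (\<eta> x)}" for P
    unfolding ring_word_def sites(1)[symmetric] by (rule card_filter_map[OF sites(2)])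
  have count_list: "count_list w l = length (filter (\<lambda>k. k = l) w)" for w and l :: nat
    by (induction w) auto
  show "count_list (ring_word n \<eta>) 1 = card {x \<in> {1..n}. \<eta> x = 1}"
    unfolding count_list by (rule count)
  have "length (ring_word n \<eta>) = n"
    using assms by (simp add: ring_word_def del: upt_Suc)
  then show "count_list (ring_word n \<eta>) 3 + card {x \<in> {1..n}. \<eta> x \<noteq> 3} = n"
    unfolding count_list
    using count[of "\<lambda>k. k \<noteq> 3"] sum_length_filter_compl[of "\<lambda>k. k = 3" "ring_word n \<eta>"]
    by linarith
qed

lemma ring_labels_counts:
  shows "arrivals z < services z \<Longrightarrow> count_list (ring_labels z) 1 = arrivals z"
    and "count_list (ring_labels z) 3 + services z = length z"
proof -
  assume "arrivals z < services z"
  then have "queue_run z (queue_run z 0) = queue_run z 0"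
    using queue_run_fixed_iff by blast
  then show "count_list (ring_labels z) 1 = arrivals z"
    using labels_conservation[of z "queue_run z 0"] by (simp add: ring_labels_def)
qed (simp add: ring_labels_def labels_unserved)

lemma ring_word_surj:
  assumes z: "z \<in> two_lines n s t" and "s < t" "0 < n"
  obtains \<eta> where "\<eta> \<in> words n s t" "ring_word n \<eta> = ring_labels z"
proof -
  define w where "w = ring_labels z"
  \<comment> \<open>Inverse of \<open>ring_word\<close>: site 2 comes first, so site
    \<open>x\<close> has index \<open>x - 2\<close>, and site 1 has the last index.\<close>
  define \<eta> where "\<eta> = (\<lambda>x\<in>{1..n}. w ! (if x = 1 then n - 1 else x - 2))"
  have len: "length w = n"
    using z by (simp add: w_def two_lines_def)
  have len': "length (ring_word n \<eta>) = n"
    using \<open>0 < n\<close> by (simp add: ring_word_def del: upt_Suc)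
  have word: "ring_word n \<eta> = w"
  proof (rule nth_equalityI)
    fix k assume "k < length (ring_word n \<eta>)"
    then have k: "k < n" using len' by simp
    show "ring_word n \<eta> ! k = w ! k"
    proof (cases "k = n - 1")
      case True
      then show ?thesis
        using \<open>0 < n\<close> by (simp add: ring_word_def nth_append \<eta>_def del: upt_Suc)
    next
      case False
      then have "Suc (Suc k) \<le> n" "k < n - 1" using k by simp_all
      then show ?thesis
        by (simp add: ring_word_def nth_append \<eta>_def del: upt_Suc)
    qed
  qed (simp add: len len')
  have "arrivals z < services z" "arrivals z = s" "services z = t" "length z = n"
    using z \<open>s < t\<close> by (simp_all add: two_lines_def)
  then have "card {x \<in> {1..n}. \<eta> x = 1} = s" "card {x \<in> {1..n}. \<eta> x \<noteq> 3} = t"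
    using ring_word_counts[OF \<open>0 < n\<close>, of \<eta>] ring_labels_counts[of z]
    unfolding word w_def by linarith+
  moreover have "\<eta> \<in> {1..n} \<rightarrow>\<^sub>E {1, 2, 3}"
  proof (rule PiE_I)
    fix x assume "x \<in> {1..n}"
    then have "\<eta> x \<in> set w"
      using set_ring_word[OF \<open>0 < n\<close>, of \<eta>] word by blast
    then show "\<eta> x \<in> {1, 2, 3}"
      using set_labels[of z "queue_run z 0"] unfolding w_def ring_labels_def by blast
  qed (auto simp: \<eta>_def)
  ultimately show ?thesis
    using that word by (simp add: words_def w_def)
qed

lemma labels_of_word:
  assumes "\<eta> \<in> words n s t" "ring_labels z = ring_word n \<eta>" "arrivals z < services z" "0 < n"
  shows "z \<in> two_lines n s t"
proof -
  have "length z = length (ring_word n \<eta>)"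
    using length_ring_labels[of z] assms(2) by simp
  then have len: "length z = n"
    using \<open>0 < n\<close> by (simp add: ring_word_def del: upt_Suc)
  have "card {x \<in> {1..n}. \<eta> x = 1} = s" "card {x \<in> {1..n}. \<eta> x \<noteq> 3} = t"
    using assms(1) by (simp_all add: words_def)
  then have "arrivals z = s" "services z = t"
    using ring_word_counts[OF \<open>0 < n\<close>, of \<eta>] ring_labels_counts[of z] assms(3) len
    unfolding assms(2) by linarith+
  with len show ?thesis
    by (simp add: two_lines_def)
qed

text \<open>The letter counts of a word fix the numbers of arrivals and services, so the
  configurations behind the words in \<open>words n s t\<close> are those of
  \<open>two_lines n s t\<close>, each behind exactly one word.\<close>

lemma sum_ring_weight:
  assumes "s < t" "0 < n"
  shows "(\<Sum>\<eta>\<in>{\<eta> \<in> words n s t. P (ring_word n \<eta>)}. ring_weight (ring_word n \<eta>)) =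
    card {z \<in> two_lines n s t. P (ring_labels z)}"
proof -
  let ?Z = "\<lambda>\<eta>. {z. arrivals z < services z \<and> ring_labels z = ring_word n \<eta>}"
  let ?W = "{\<eta> \<in> words n s t. P (ring_word n \<eta>)}"
  have "{z \<in> two_lines n s t. P (ring_labels z)} = (\<Union>\<eta>\<in>?W. ?Z \<eta>)"
  proof (intro set_eqI iffI)
    fix z assume z: "z \<in> {z \<in> two_lines n s t. P (ring_labels z)}"
    then obtain \<eta> where "\<eta> \<in> words n s t" "ring_word n \<eta> = ring_labels z"
      using ring_word_surj[of z n s t] assms by blast
    moreover have "arrivals z < services z"
      using z \<open>s < t\<close> by (simp add: two_lines_def)
    ultimately show "z \<in> (\<Union>\<eta>\<in>?W. ?Z \<eta>)"
      using z by auto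
  next
    fix z assume "z \<in> (\<Union>\<eta>\<in>?W. ?Z \<eta>)"
    then show "z \<in> {z \<in> two_lines n s t. P (ring_labels z)}"
      using labels_of_word[of _ n s t z] assms by auto
  qed
  moreover have "card (\<Union>\<eta>\<in>?W. ?Z \<eta>) = (\<Sum>\<eta>\<in>?W. card (?Z \<eta>))"
  proof (rule card_UN_disjoint)
    show "\<forall>\<eta>\<in>?W. finite (?Z \<eta>)"
    proof
      fix \<eta>
      show "finite (?Z \<eta>)"
        by (rule finite_subset[OF _ finite_columns[of "length (ring_word n \<eta>)" "\<lambda>_. True"]])
          (auto simp flip: length_ring_labels)
    qed
    show "\<forall>\<eta>\<in>?W. \<forall>\<theta>\<in>?W. \<eta> \<noteq> \<theta> \<longrightarrow> ?Z \<eta> \<inter> ?Z \<theta> = {}"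
    proof (intro ballI impI)
      fix \<eta> \<theta> assume "\<eta> \<in> ?W" "\<theta> \<in> ?W" "\<eta> \<noteq> \<theta>"
      then have "ring_word n \<eta> \<noteq> ring_word n \<theta>"
        using ring_word_inj[of \<eta> n s t \<theta>] assms(2) by blast
      then show "?Z \<eta> \<inter> ?Z \<theta> = {}"
        by auto
    qed
  qed simp
  ultimately show ?thesis
    by (simp add: ring_weight_def)
qed

section \<open>Merging species\<close>

definition species_class :: "nat \<Rightarrow> nat \<Rightarrow> nat \<Rightarrow> nat" where
  "species_class s t x = (if x \<le> s then 1 else if x \<le> t then 2 else 3)"

definition project :: "nat \<Rightarrow> nat \<Rightarrow> nat \<Rightarrow> (nat \<Rightarrow> nat) \<Rightarrow> nat \<Rightarrow> nat" where
  "project n s t v = (\<lambda>x\<in>{1..n}. species_class s t (v x))"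

lemma finite_tasep_states [simp]: "finite (tasep_states n)"
  unfolding tasep_states_def by (rule finite_permutations) simp

lemma swap_in_tasep_states:
  assumes "v \<in> tasep_states n" "i \<in> {1..n}"
  shows "swap n i v \<in> tasep_states n"
  using assms(1) unfolding tasep_states_def mem_Collect_eq
  by (rule permutes_compose[OF permutes_swap_id[OF left_site_in[OF assms(2)] assms(2)]])

lemma swap_swap: "swap n i (swap n i v) = v"
  by (simp add: comp_assoc)

lemma bij_betw_swap:
  assumes "i \<in> {1..n}"
  shows "bij_betw (swap n i) (tasep_states n) (tasep_states n)"
  by (rule bij_betwI[where g = "swap n i"]) (use swap_in_tasep_states[OF _ assms] swap_swap in auto)

lemma tasep_rate_eq_sum:
  "tasep_rate n u v =
     (\<Sum>i\<in>{1..n}. if u (left_site n i) > u i \<and> v = swap n i u then 1 else 0)"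
  unfolding tasep_rate_def by (simp add: sum.If_cases Int_def)

text \<open>The sums over states are regrouped by the site whose clock rings. As a swap is an
  involution, the only state that can enter \<open>v\<close> through site \<open>i\<close> is
  \<open>swap n i v\<close>, and it does so exactly if \<open>v\<close> has an ascent there.\<close>

lemma stationary_balance:
  assumes stat: "tasep_stationary n p" and n: "2 \<le> n" and v: "v \<in> tasep_states n"
  shows "(\<Sum>i\<in>{1..n}. if v (left_site n i) < v i then pmf p (swap n i v) else 0) =
    (\<Sum>i\<in>{1..n}. if v (left_site n i) > v i then pmf p v else 0)"
proof -
  let ?S = "tasep_states n"
  have moved: "swap n i u \<noteq> u" if "u (left_site n i) > u i" for i u
  proof
    assume "swap n i u = u"
    then have "swap n i u i = u i" by simp
    then show False using that by simp
  qed
  have out: "(\<Sum>x\<in>?S - {v}. tasep_rate n v x) = (\<Sum>i\<in>{1..n}. if v (left_site n i) > v i then 1 else 0)"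
  proof -
    have "(\<Sum>x\<in>?S - {v}. tasep_rate n v x) =
        (\<Sum>i\<in>{1..n}. \<Sum>x\<in>?S - {v}. if v (left_site n i) > v i \<and> x = swap n i v then 1 else 0)"
      unfolding tasep_rate_eq_sum by (rule sum.swap)
    also have "\<dots> = (\<Sum>i\<in>{1..n}. if v (left_site n i) > v i then 1 else 0)"
    proof (rule sum.cong[OF refl])
      fix i assume i: "i \<in> {1..n}"
      show "(\<Sum>x\<in>?S - {v}. if v (left_site n i) > v i \<and> x = swap n i v then 1 else 0) =
          (if v (left_site n i) > v i then 1 else (0::real))"
      proof (cases "v (left_site n i) > v i")
        case True
        then have "swap n i v \<in> ?S - {v}"
          using moved[where i = i and u = v] swap_in_tasep_states[OF v i] by simp
        then show ?thesis
          using True by (simp del: comp_apply)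
      qed simp
    qed
    finally show ?thesis .
  qed
  have inflow: "(\<Sum>u\<in>?S. pmf p u * tasep_rate n u v) =
      (\<Sum>i\<in>{1..n}. if v (left_site n i) < v i then pmf p (swap n i v) else 0)"
  proof -
    have "(\<Sum>u\<in>?S. pmf p u * tasep_rate n u v) =
        (\<Sum>i\<in>{1..n}. \<Sum>u\<in>?S. if u (left_site n i) > u i \<and> v = swap n i u then pmf p u else 0)"
      unfolding tasep_rate_eq_sum sum_distrib_left
      by (subst sum.swap) (intro sum.cong refl, simp)
    also have "\<dots> = (\<Sum>i\<in>{1..n}. if v (left_site n i) < v i then pmf p (swap n i v) else 0)"
    proof (rule sum.cong[OF refl])
      fix i assume i: "i \<in> {1..n}"
      have iff: "u (left_site n i) > u i \<and> v = swap n i u \<longleftrightarrow>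
          v (left_site n i) < v i \<and> u = swap n i v" for u
    proof
      assume u: "u (left_site n i) > u i \<and> v = swap n i u"
      then have "swap n i v = u"
        using swap_swap by simp
      with u show "v (left_site n i) < v i \<and> u = swap n i v"
        by simp
    next
      assume u: "v (left_site n i) < v i \<and> u = swap n i v"
      then have "swap n i u = v"
        using swap_swap by simp
      with u show "u (left_site n i) > u i \<and> v = swap n i u"
        by simp
    qed
      show "(\<Sum>u\<in>?S. if u (left_site n i) > u i \<and> v = swap n i u then pmf p u else 0) =
          (if v (left_site n i) < v i then pmf p (swap n i v) else 0)"
        unfolding iff using swap_in_tasep_states[OF v i]
        by (cases "v (left_site n i) < v i") (simp_all del: comp_apply)
    qed
    finally show ?thesis .
  qed
  \<comment> \<open>The generator replaces the rate on the diagonal; writing it as rate minus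
    outflow requires this rate to vanish.\<close>
  have diag: "tasep_rate n v v = 0"
    unfolding tasep_rate_eq_sum
  proof (rule sum.neutral, rule ballI)
    fix i
    show "(if v (left_site n i) > v i \<and> v = swap n i v then 1 else 0 :: real) = 0"
      using moved[where i = i and u = v] by (metis (no_types, lifting))
  qed
  have gen: "pmf p u * tasep_generator n u v = pmf p u * tasep_rate n u v -
      (if u = v then pmf p v * (\<Sum>x\<in>?S - {v}. tasep_rate n v x) else 0)" for u
    using diag by (simp add: tasep_generator_def)
  have "(\<Sum>u\<in>?S. pmf p u * tasep_generator n u v) = 0"
    using stat v by (simp add: tasep_stationary_def)
  then have "(\<Sum>u\<in>?S. pmf p u * tasep_rate n u v) = pmf p v * (\<Sum>x\<in>?S - {v}. tasep_rate n v x)"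
    unfolding gen sum_subtractf using v by simp
  then show ?thesis
    unfolding inflow out by (simp add: sum_distrib_left if_distrib cong: if_cong)
qed

lemma project_swap:
  assumes "i \<in> {1..n}"
  shows "project n s t (swap n i v) = swap n i (project n s t v)"
proof
  fix x
  have "Transposition.transpose (left_site n i) i x \<in> {1..n} \<longleftrightarrow> x \<in> {1..n}"
    using assms left_site_in[OF assms] by (auto simp: Transposition.transpose_def)
  then show "project n s t (swap n i v) x = swap n i (project n s t v) x"
    by (simp only: project_def comp_apply restrict_def)
qed

lemma project_in_words:
  assumes "v \<in> tasep_states n" "s \<le> t" "t \<le> n"
  shows "project n s t v \<in> words n s t"
proof -
  have v: "bij_betw v {1..n} {1..n}"
    using assms(1) by (simp add: tasep_states_def permutes_imp_bij)
  have card: "card {x \<in> {1..n}. v x \<le> k} = k" if "k \<le> n" for k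
  proof -
    have "bij_betw v {x \<in> {1..n}. v x \<le> k} {y \<in> {1..n}. y \<le> k}"
      using v by (rule bij_betw_Collect) simp
    then have "card {x \<in> {1..n}. v x \<le> k} = card {y \<in> {1..n}. y \<le> k}"
      by (rule bij_betw_same_card)
    also have "{y \<in> {1..n}. y \<le> k} = {1..k}"
      using that by auto
    finally show ?thesis by simp
  qed
  have "{x \<in> {1..n}. project n s t v x = 1} = {x \<in> {1..n}. v x \<le> s}"
    "{x \<in> {1..n}. project n s t v x \<noteq> 3} = {x \<in> {1..n}. v x \<le> t}"
    using assms(2) by (auto simp: project_def species_class_def split: if_splits)
  moreover have "project n s t v \<in> {1..n} \<rightarrow>\<^sub>E {1, 2, 3}"
    by (auto simp: project_def species_class_def)
  ultimately show ?thesis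
    using card[of s] card[of t] assms(2,3) by (simp add: words_def)
qed

definition projected_pmf :: "nat \<Rightarrow> nat \<Rightarrow> nat \<Rightarrow> (nat \<Rightarrow> nat) pmf \<Rightarrow> (nat \<Rightarrow> nat) \<Rightarrow> real" where
  "projected_pmf n s t p \<eta> = (\<Sum>v\<in>{v \<in> tasep_states n. project n s t v = \<eta>}. pmf p v)"

text \<open>The merging is compatible with the balance site by site: different classes at the two
  sites order the species alike in every state of the fibre, and equal classes contribute nothing in
  total.\<close>

lemma projected_balance:
  assumes stat: "tasep_stationary n p" and n: "2 \<le> n" and st: "s \<le> t"
  shows "(\<Sum>i\<in>{1..n}. if \<eta> (left_site n i) < \<eta> i then projected_pmf n s t p (swap n i \<eta>) else 0) =
    (\<Sum>i\<in>{1..n}. if \<eta> (left_site n i) > \<eta> i then projected_pmf n s t p \<eta> else 0)"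
proof -
  define Fib where "Fib \<eta> = {v \<in> tasep_states n. project n s t v = \<eta>}" for \<eta>
  define gain where "gain i = (\<Sum>v\<in>Fib \<eta>. if v (left_site n i) < v i then pmf p (swap n i v) else 0)" for i
  define loss where "loss i = (\<Sum>v\<in>Fib \<eta>. if v (left_site n i) > v i then pmf p v else 0)" for i
  have "(\<Sum>v\<in>Fib \<eta>. \<Sum>i\<in>{1..n}. if v (left_site n i) < v i then pmf p (swap n i v) else 0) =
      (\<Sum>v\<in>Fib \<eta>. \<Sum>i\<in>{1..n}. if v (left_site n i) > v i then pmf p v else 0)"
    by (intro sum.cong refl stationary_balance[OF stat n]) (simp add: Fib_def)
  then have total: "(\<Sum>i\<in>{1..n}. gain i) = (\<Sum>i\<in>{1..n}. loss i)"
    unfolding gain_def loss_def by (subst (1 2) sum.swap)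
  have reindex: "(\<Sum>v\<in>Fib \<eta>. g (swap n i v)) = (\<Sum>v\<in>Fib (swap n i \<eta>). g v)"
    if i: "i \<in> {1..n}" for i and g :: "(nat \<Rightarrow> nat) \<Rightarrow> real"
  proof (rule sum.reindex_bij_betw)
    have "bij_betw (swap n i) {v \<in> tasep_states n. project n s t v = \<eta>}
        {v \<in> tasep_states n. project n s t v = swap n i \<eta>}"
    proof (rule bij_betw_Collect[OF bij_betw_swap[OF i]])
      fix v
      have "swap n i (project n s t v) = swap n i \<eta> \<longleftrightarrow> project n s t v = \<eta>"
        using swap_swap by metis
      then show "project n s t (swap n i v) = swap n i \<eta> \<longleftrightarrow> project n s t v = \<eta>"
        by (simp only: project_swap[OF i])
    qed
    then show "bij_betw (swap n i) (Fib \<eta>) (Fib (swap n i \<eta>))"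
      by (simp only: Fib_def)
  qed
  have balance: "gain i - loss i =
      (if \<eta> (left_site n i) < \<eta> i then projected_pmf n s t p (swap n i \<eta>) else 0) -
      (if \<eta> (left_site n i) > \<eta> i then projected_pmf n s t p \<eta> else 0)"
    if i: "i \<in> {1..n}" for i
  proof -
    have cls: "\<eta> x = species_class s t (v x)" if "v \<in> Fib \<eta>" "x \<in> {1..n}" for v x
      using that by (auto simp: Fib_def project_def)
    have mono: "species_class s t x \<le> species_class s t y" if "x \<le> y" for x y
      using that st by (auto simp: species_class_def)
    consider "\<eta> (left_site n i) < \<eta> i" | "\<eta> (left_site n i) > \<eta> i" | "\<eta> (left_site n i) = \<eta> i"
      by linarith
    then show ?thesis
    proof cases
      case 1
      have "v (left_site n i) < v i \<and> \<not> v i < v (left_site n i)" if "v \<in> Fib \<eta>" for v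
        using 1 cls[OF that i] cls[OF that left_site_in[OF i]] mono[of "v i" "v (left_site n i)"]
        by linarith
      then have "gain i = (\<Sum>v\<in>Fib \<eta>. pmf p (swap n i v))" "loss i = 0"
        unfolding gain_def loss_def
        by (auto intro!: sum.cong sum.neutral simp del: comp_apply)
      then show ?thesis
        using 1 reindex[OF i, of "pmf p"] by (simp add: projected_pmf_def Fib_def)
    next
      case 2
      have "v i < v (left_site n i) \<and> \<not> v (left_site n i) < v i" if "v \<in> Fib \<eta>" for v
        using 2 cls[OF that i] cls[OF that left_site_in[OF i]] mono[of "v (left_site n i)" "v i"]
        by linarith
      then have "loss i = (\<Sum>v\<in>Fib \<eta>. pmf p v)" "gain i = 0"
        unfolding gain_def loss_def
        by (auto intro!: sum.cong sum.neutral simp del: comp_apply)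
      then show ?thesis
        using 2 by (simp add: projected_pmf_def Fib_def)
    next
      \<comment> \<open>The swap permutes the fibre and exchanges its ascents and descents at
        \<open>i\<close>, so gain and loss cancel although neither need be 0.\<close>
      case 3
      have "swap n i \<eta> = \<eta>"
        using 3 by (auto simp: Transposition.transpose_def fun_eq_iff)
      moreover have "gain i = (\<Sum>v\<in>Fib \<eta>. (\<lambda>v. if v (left_site n i) > v i then pmf p v else 0) (swap n i v))"
        unfolding gain_def by (intro sum.cong refl) simp
      ultimately have "gain i = loss i"
        unfolding loss_def using reindex[OF i, of "\<lambda>v. if v (left_site n i) > v i then pmf p v else 0"] by simp
      then show ?thesis using 3 by simp
    qed
  qed
  have "(\<Sum>i\<in>{1..n}. gain i - loss i) = 0"
    using total by (simp add: sum_subtractf)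
  then show ?thesis
    using balance by (simp add: sum_subtractf)
qed

section \<open>Joint law of two sites\<close>

lemma prob_eq_sum:
  assumes "tasep_stationary n p"
  shows "measure_pmf.prob p {w. P w} = (\<Sum>w\<in>{w \<in> tasep_states n. P w}. pmf p w)"
proof -
  have "measure_pmf.prob p {w. P w} = measure_pmf.prob p {w \<in> tasep_states n. P w}"
    using assms by (intro measure_pmf.finite_measure_eq_AE)
      (auto simp: tasep_stationary_def AE_measure_pmf_iff)
  also have "\<dots> = (\<Sum>w\<in>{w \<in> tasep_states n. P w}. pmf p w)"
    by (rule measure_measure_pmf_finite) simp
  finally show ?thesis .
qed

lemma prob_low_high:
  assumes stat: "tasep_stationary n p" and a: "2 \<le> a" "a \<le> n" and st: "s + (a - 2) < t" "t \<le> n"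
  shows "measure_pmf.prob p {w. w 1 \<le> s \<and> t < w a} = real s * real (n - t) / (real n)\<^sup>2"
proof -
  have n: "2 \<le> n" "0 < n" and "s < t" "s \<le> t"
    using a st by auto
  obtain \<kappa> where \<kappa>: "\<And>\<eta>. \<eta> \<in> words n s t \<Longrightarrow>
      projected_pmf n s t p \<eta> = \<kappa> * real (ring_weight (ring_word n \<eta>))"
    using words_balance_unique[OF \<open>s < t\<close> n(1) projected_balance[OF stat n(1) \<open>s \<le> t\<close>]] by blast
  have prob: "measure_pmf.prob p {w. P (project n s t w)} =
      \<kappa> * real (card {z \<in> two_lines n s t. P' (ring_labels z)})"
    if P: "\<And>\<eta>. \<eta> \<in> words n s t \<Longrightarrow> P \<eta> \<longleftrightarrow> P' (ring_word n \<eta>)" for P P'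
  proof -
    let ?W = "{\<eta> \<in> words n s t. P' (ring_word n \<eta>)}"
    have "measure_pmf.prob p {w. P (project n s t w)} =
        (\<Sum>w\<in>{w \<in> tasep_states n. P (project n s t w)}. pmf p w)"
      by (rule prob_eq_sum[OF stat])
    also have "\<dots> = (\<Sum>\<eta>\<in>?W. \<Sum>w\<in>{w \<in> {w \<in> tasep_states n. P (project n s t w)}. project n s t w = \<eta>}. pmf p w)"
      using project_in_words[OF _ \<open>s \<le> t\<close> st(2)] P
      by (intro sum.group[symmetric]) auto
    also have "\<dots> = (\<Sum>\<eta>\<in>?W. projected_pmf n s t p \<eta>)"
      unfolding projected_pmf_def by (intro sum.cong refl) (use P in auto)
    also have "\<dots> = (\<Sum>\<eta>\<in>?W. \<kappa> * real (ring_weight (ring_word n \<eta>)))"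
      by (intro sum.cong refl \<kappa>) simp
    also have "\<dots> = \<kappa> * real (\<Sum>\<eta>\<in>?W. ring_weight (ring_word n \<eta>))"
      by (simp add: sum_distrib_left)
    finally show ?thesis
      using sum_ring_weight[OF \<open>s < t\<close> n(2)] by simp
  qed
  \<comment> \<open>The event that always holds determines \<open>\<kappa>\<close> and turns
    probabilities into proportions of queue configurations.\<close>
  have norm: "\<kappa> * real (card (two_lines n s t)) = 1"
    using prob[of "\<lambda>_. True" "\<lambda>_. True"] measure_pmf.prob_space[of p] by simp
  have event: "\<eta> a = 3 \<and> \<eta> 1 = 1 \<longleftrightarrow>
      ring_word n \<eta> ! (a - 2) = 3 \<and> last (ring_word n \<eta>) = 1" for \<eta>
  proof -
    have "a - 2 < n - 1" "Suc (Suc (a - 2)) = a"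
      using a by simp_all
    then have "ring_word n \<eta> ! (a - 2) = \<eta> a"
      by (simp add: ring_word_def nth_append del: upt_Suc)
    moreover have "last (ring_word n \<eta>) = \<eta> 1"
      by (simp add: ring_word_def del: upt_Suc)
    ultimately show ?thesis by simp
  qed
  have "{w. w 1 \<le> s \<and> t < w a} = {w. project n s t w a = 3 \<and> project n s t w 1 = 1}"
    using a \<open>s \<le> t\<close> by (auto simp: project_def species_class_def split: if_splits)
  then have "measure_pmf.prob p {w. w 1 \<le> s \<and> t < w a} = \<kappa> *
      real (card {z \<in> two_lines n s t. ring_labels z ! (a - 2) = 3 \<and> last (ring_labels z) = 1})"
    using prob[of "\<lambda>\<eta>. \<eta> a = 3 \<and> \<eta> 1 = 1" "\<lambda>w. w ! (a - 2) = 3 \<and> last w = 1", OF event] by simp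
  also have "\<dots> = \<kappa> * (real s * real (n - t) / (real n)\<^sup>2 * real (card (two_lines n s t)))"
    using last_label_pair_proportion[of "a - 2" "n - 1" s t] a st n by simp
  also have "\<dots> = real s * real (n - t) / (real n)\<^sup>2 * (\<kappa> * real (card (two_lines n s t)))"
    by simp
  finally show ?thesis
    by (simp add: norm)
qed

theorem corollary5p2:
  fixes n i j a :: nat and p :: "(nat \<Rightarrow> nat) pmf"
  assumes "tasep_stationary n p"
    and "1 \<le> i" and "i < j" and "j \<le> n"
    and "2 \<le> a" and "a \<le> j - i"
  shows "measure_pmf.prob p {w. w 1 = i \<and> w a = j} = 1 / (real n)\<^sup>2"
proof -
  define G where "G s t = measure_pmf.prob p {w. w 1 \<le> s \<and> t < w a}" for s t
  \<comment> \<open>The mixed difference evaluates \<open>G\<close> at \<open>s\<close> in {i - 1,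
    i} and \<open>t\<close> in {j - 1, j}. The tightest case is \<open>s = i\<close>,
    \<open>t = j - 1\<close>, where \<open>s + (a - 2) < t\<close> is exactly
    \<open>a \<le> j - i\<close>.\<close>
  have G: "G s t = real s * real (n - t) / (real n)\<^sup>2" if "s \<le> i" "j - 1 \<le> t" "t \<le> n" for s t
    unfolding G_def
  proof (rule prob_low_high[OF assms(1)])
    show "2 \<le> a" "a \<le> n" "s + (a - 2) < t" "t \<le> n"
      using assms(2-6) that by linarith+
  qed
  have diff: "measure_pmf.prob p A - measure_pmf.prob p B = measure_pmf.prob p C"
    if "A - B = C" "B \<subseteq> A" for A B C
    using measure_pmf.finite_measure_Diff[of A p B] that by simp
  have row: "G i t - G (i - 1) t = measure_pmf.prob p {w. w 1 = i \<and> t < w a}" for t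
    unfolding G_def using assms(2) by (intro diff) auto
  have "(G i (j - 1) - G (i - 1) (j - 1)) - (G i j - G (i - 1) j) =
      measure_pmf.prob p {w. w 1 = i \<and> w a = j}"
    unfolding row using assms(3) by (intro diff) auto
  moreover have "real (n - (j - 1)) = real (n - j) + 1" "real (i - 1) = real i - 1"
    using assms(2-4) by simp_all
  moreover have "G i (j - 1) = real i * real (n - (j - 1)) / (real n)\<^sup>2"
    "G (i - 1) (j - 1) = real (i - 1) * real (n - (j - 1)) / (real n)\<^sup>2"
    "G i j = real i * real (n - j) / (real n)\<^sup>2"
    "G (i - 1) j = real (i - 1) * real (n - j) / (real n)\<^sup>2"
    by (rule G; use assms(4) in linarith)+
  moreover have "(r * (x + 1) / N - (r - 1) * (x + 1) / N) - (r * x / N - (r - 1) * x / N) = 1 / N" for r x N :: real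
    by (simp only: diff_divide_distrib[symmetric]) (simp add: algebra_simps)
  ultimately show ?thesis
    by metis
qed

end
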